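(* Let $G=(V,E)$ be a digraph with $n$ vertices $v_1,\ldots,v_n$, spectral radius $\rho(G)$, and no sinks. Then for any integers $L>0$ and $k\ge0$, \[ \min_{1\le i\le n}\left(\frac{d_i^{(k+L)+}}{d_i^{k+}}\right)^{1/L}\le \rho(G)\le \max_{1\le i\le n}\left(\frac{d_i^{(k+L)+}}{d_i^{k+}}\right)^{1/L}. \] Moreover, if $G$ is strongly connected, then equality holds on either side of this inequality if and only if $G$ is average $(k+1)$-outdegree regular or average $(k+1)$-outdegree $r$-quasiregular (or both), where $r=\gcd(L,h(G))$.
   Context: Digraphs may have self-loops and multiple arcs. The adjacency matrix $A(G)=(a_{ij})$ has $a_{ij}$ equal to the number of arcs from $v_i$ to $v_j$; $\rho(G)$ is the spectral radius (maximum eigenvalue modulus) of $A(G)$. $G$ is strongly connected iff $A(G)$ is irreducible, and then $h(G)$, the index of imprimitivity, is the number of eigenvalues of $A(G)$ of modulus $\rho(G)$. The $k$-outdegree $d_i^{k+}$ of $v_i$ is the number of directed walks of length $k$ starting at $v_i$, i.e. $d_i^{k+}=\sum_j a_{ij}^{(k)}$ where $a_{ij}^{(k)}$ is the $(i,j)$ entry of $A(G)^k$; $d_i^{0+}=1$ and $d_i^{+}=d_i^{1+}$ is the outdegree. A sink is a vertex with outdegree $0$. For $\kappa\ge1$, $G$ is average $\kappa$-outdegree regular if $d_i^{\kappa+}/d_i^{(\kappa-1)+}$ is the same constant for all $v_i\in V$. For $r>1$, $G$ is cyclically $r$-partite if $r$ divides $h(G)$; then $V$ is partitioned into nonempty classes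 $V_1,\ldots,V_r$ such that every arc with initial vertex in $V_j$ has terminal vertex in $V_{(j\bmod r)+1}$. $G$ is average $\kappa$-outdegree $r$-quasiregular if it is cyclically $r$-partite and there are constants $c_1,\ldots,c_r$ with $d_i^{\kappa+}/d_i^{(\kappa-1)+}=c_j$ for all $v_i\in V_j$, $j=1,\ldots,r$. *)

theory Defs
  imports
    "Graph_Theory.Arc_Walk"
    "Graph_Theory.Digraph_Component"
    "Jordan_Normal_Form.Spectral_Radius"
begin

text \<open>
  A digraph with possible self-loops and multiple arcs is a \<^locale>\<open>fin_digraph\<close>.
  The list \<open>vs\<close> below enumerates the vertices as \<open>v\<^sub>1, \<dots>, v\<^sub>n\<close>
  (with indices shifted to \<open>0, \<dots>, n - 1\<close>).
\<close>

definition adjacency_mat :: "('a, 'b) pre_digraph \<Rightarrow> 'a list \<Rightarrow> complex mat" where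
  "adjacency_mat G vs = Matrix.mat (length vs) (length vs)
     (\<lambda>(i, j). of_nat (card {e \<in> arcs G. tail G e = vs ! i \<and> head G e = vs ! j}))"

definition digraph_spectral_radius :: "('a, 'b) pre_digraph \<Rightarrow> 'a list \<Rightarrow> real" where
  "digraph_spectral_radius G vs = spectral_radius (adjacency_mat G vs)"

text \<open>Eigenvalues are counted with algebraic multiplicity.\<close>

definition imprimitivity_index :: "('a, 'b) pre_digraph \<Rightarrow> 'a list \<Rightarrow> nat" where
  "imprimitivity_index G vs =
     (\<Sum>z | eigenvalue (adjacency_mat G vs) z \<and> cmod z = digraph_spectral_radius G vs.
        Polynomial.order z (char_poly (adjacency_mat G vs)))"

text \<open>Walks are lists of arcs, so parallel arcs give distinct walks.\<close>

definition k_outdegree :: "('a, 'b) pre_digraph \<Rightarrow> nat \<Rightarrow> 'a \<Rightarrow> nat" where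
  "k_outdegree G k u = card {p. (\<exists>v. pre_digraph.awalk G u p v) \<and> length p = k}"

definition is_sink :: "('a, 'b) pre_digraph \<Rightarrow> 'a \<Rightarrow> bool" where
  "is_sink G u \<longleftrightarrow> u \<in> verts G \<and> out_degree G u = 0"

definition avg_outdegree_regular :: "('a, 'b) pre_digraph \<Rightarrow> nat \<Rightarrow> bool" where
  "avg_outdegree_regular G \<kappa> \<longleftrightarrow> \<kappa> \<ge> 1 \<and>
     (\<exists>c::real. \<forall>u\<in>verts G. real (k_outdegree G \<kappa> u) / real (k_outdegree G (\<kappa> - 1) u) = c)"

text \<open>The index of imprimitivity is only meaningful for strongly connected digraphs.\<close>

definition cyclically_partite :: "('a, 'b) pre_digraph \<Rightarrow> 'a list \<Rightarrow> nat \<Rightarrow> bool" where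
  "cyclically_partite G vs r \<longleftrightarrow>
     strongly_connected G \<and> r > 1 \<and> r dvd imprimitivity_index G vs"

definition cyclic_partition :: "('a, 'b) pre_digraph \<Rightarrow> nat \<Rightarrow> (nat \<Rightarrow> 'a set) \<Rightarrow> bool" where
  "cyclic_partition G r V \<longleftrightarrow>
     (\<Union>j\<in>{1..r}. V j) = verts G \<and> disjoint_family_on V {1..r} \<and> (\<forall>j\<in>{1..r}. V j \<noteq> {}) \<and>
     (\<forall>j\<in>{1..r}. \<forall>e\<in>arcs G. tail G e \<in> V j \<longrightarrow> head G e \<in> V (j mod r + 1))"

definition avg_outdegree_quasiregular ::
    "('a, 'b) pre_digraph \<Rightarrow> 'a list \<Rightarrow> nat \<Rightarrow> nat \<Rightarrow> bool" where
  "avg_outdegree_quasiregular G vs \<kappa> r \<longleftrightarrow> \<kappa> \<ge> 1 \<and> cyclically_partite G vs r \<and>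
     (\<exists>V. cyclic_partition G r V \<and>
        (\<exists>c :: nat \<Rightarrow> real. \<forall>j\<in>{1..r}. \<forall>u\<in>V j.
           real (k_outdegree G \<kappa> u) / real (k_outdegree G (\<kappa> - 1) u) = c j))"

end

theory Submission
  imports Defs
begin

text \<open>
  Let \<open>A\<close> be the adjacency matrix and \<open>x = A\<^sup>k 1\<close>, the positive vector of \<open>k\<close>-outdegrees. The bounds are the
  Collatz--Wielandt bounds for \<open>A\<^sup>L\<close> and \<open>x\<close>: the upper one follows by comparing an eigenvector with a
  multiple of \<open>x\<close>, the lower one since \<open>m x \<le> A\<^sup>L x\<close> forces powers of \<open>A\<close> to grow like
  powers of \<open>root L m\<close>. If \<open>A\<close> is irreducible and one of the inequalities \<open>m x \<le> A\<^sup>L x\<close>, \<open>A\<^sup>L x \<le> M x\<close> is strict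
  somewhere, then replacing \<open>x\<close> by \<open>x + A x + \<dots> + A\<^sup>N x\<close> makes it strict everywhere, so equality
  in either bound means \<open>A\<^sup>L x = \<rho>\<^sup>L x\<close>.

  Then \<open>p = \<Sum>s<L. \<rho>\<^sup>-\<^sup>s A\<^sup>s x\<close> is a positive eigenvector for \<open>\<rho>\<close>. By a maximum principle every
  eigenvector for \<open>\<rho> \<theta>\<close> with \<open>\<bar>\<theta>\<bar> = 1\<close> is \<open>p w\<close> where \<open>w\<close> is multiplied by \<open>\<theta>\<close> along each arc. Hence these
  eigenvalues are simple, the phases \<open>\<theta>\<close> form a finite multiplicative group, and so they are exactly the \<open>h\<close>-th roots
  of unity. Decomposing \<open>x\<close> into eigenvectors for \<open>\<rho> \<theta>\<close> with \<open>\<theta>\<^sup>L = 1\<close>, only \<open>\<theta>\<^sup>r = 1\<close> with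
  \<open>r = gcd L h\<close> contributes, so \<open>x / p\<close> is constant on the classes of the cyclic \<open>r\<close>-partition on which
  \<open>w\<close> is constant for a primitive \<open>r\<close>-th root of unity.
\<close>

section \<open>Sums over outgoing arcs\<close>

context pre_digraph
begin

text \<open>The adjacency matrix acting on functions of the vertices, free of any enumeration. The
  open value type serves walk counts in \<open>nat\<close>, positive real vectors and complex
  eigenvectors alike.\<close>

definition out_sum :: "('a \<Rightarrow> 'c::comm_monoid_add) \<Rightarrow> 'a \<Rightarrow> 'c" where
  "out_sum f u = (\<Sum>e\<in>out_arcs G u. f (head G e))"

end

context fin_digraph
begin

declare finite_out_arcs [simp]

lemma out_arc_head [simp]: "e \<in> out_arcs G u \<Longrightarrow> head G e \<in> verts G"
  by auto

lemma out_sum_cong: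
  assumes "\<And>v. v \<in> verts G \<Longrightarrow> f v = g v"
  shows "out_sum f = out_sum g"
  unfolding out_sum_def by (intro ext sum.cong) (auto simp: assms)

lemma out_sum_pow_cong:
  assumes "\<And>v. v \<in> verts G \<Longrightarrow> f v = g v" and "u \<in> verts G"
  shows "(out_sum ^^ k) f u = (out_sum ^^ k) g u"
  using assms(2)
proof (induction k arbitrary: u)
  case (Suc k)
  then show ?case using out_sum_cong[of "(out_sum ^^ k) f" "(out_sum ^^ k) g"] by simp
qed (simp add: assms(1))

lemma out_sum_scale: "out_sum (\<lambda>v. c * f v) = (\<lambda>u. (c :: 'c::semiring_0) * out_sum f u)"
  unfolding out_sum_def by (simp add: sum_distrib_left)

lemma out_sum_pow_scale:
  "(out_sum ^^ k) (\<lambda>v. c * f v) = (\<lambda>u. (c :: 'c::semiring_0) * (out_sum ^^ k) f u)"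
  by (induction k) (simp_all add: out_sum_scale)

lemma out_sum_sum: "out_sum (\<lambda>v. \<Sum>i\<in>I. f i v) = (\<lambda>u. \<Sum>i\<in>I. out_sum (f i) u)"
  unfolding out_sum_def by (intro ext) (rule sum.swap)

lemma out_sum_pow_sum:
  "(out_sum ^^ k) (\<lambda>v. \<Sum>i\<in>I. f i v) = (\<lambda>u. \<Sum>i\<in>I. (out_sum ^^ k) (f i) u)"
  by (induction k) (simp_all add: out_sum_sum)

lemma out_sum_pow_diff:
  fixes f :: "'a \<Rightarrow> 'c::ab_group_add"
  shows "(out_sum ^^ k) (\<lambda>v. f v - g v) = (\<lambda>u. (out_sum ^^ k) f u - (out_sum ^^ k) g u)"
  by (induction k) (simp_all add: out_sum_def[abs_def] sum_subtractf)

lemma out_sum_pow_of_real: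
  "(out_sum ^^ k) (\<lambda>v. of_real (f v)) = (\<lambda>u. of_real ((out_sum ^^ k) f u))"
  by (induction k) (simp_all add: out_sum_def[abs_def])

lemma out_sum_pow_swap: "out_sum ((out_sum ^^ k) f) = (out_sum ^^ k) (out_sum f)"
  by (metis funpow_swap1)

lemma out_sum_pow_eigen:
  fixes z :: "'c::comm_semiring_1"
  assumes "\<And>v. v \<in> verts G \<Longrightarrow> (out_sum ^^ L) f v = z * f v" and "u \<in> verts G"
  shows "(out_sum ^^ (L * j)) f u = z ^ j * f u"
  using assms(2)
proof (induction j arbitrary: u)
  case (Suc j)
  have "(out_sum ^^ (L * Suc j)) f u = (out_sum ^^ L) ((out_sum ^^ (L * j)) f) u"
    by (simp add: funpow_add)
  also have "\<dots> = (out_sum ^^ L) (\<lambda>v. z ^ j * f v) u"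
    by (rule out_sum_pow_cong) (simp_all add: Suc)
  also have "\<dots> = z ^ j * (z * f u)"
    by (simp only: out_sum_pow_scale assms(1)[OF Suc.prems])
  finally show ?case by (simp add: mult_ac)
qed simp

lemma out_sum_mono:
  fixes f g :: "'a \<Rightarrow> real"
  assumes "\<And>v. v \<in> verts G \<Longrightarrow> f v \<le> g v"
  shows "out_sum f u \<le> out_sum g u"
  unfolding out_sum_def by (intro sum_mono assms) simp

lemma out_sum_pow_mono:
  fixes f g :: "'a \<Rightarrow> real"
  assumes "\<And>v. v \<in> verts G \<Longrightarrow> f v \<le> g v" and "u \<in> verts G"
  shows "(out_sum ^^ k) f u \<le> (out_sum ^^ k) g u"
  using assms(2) by (induction k arbitrary: u) (simp_all add: assms(1) out_sum_mono)

lemma out_sum_pow_nonneg: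
  fixes f :: "'a \<Rightarrow> real"
  assumes "\<And>v. v \<in> verts G \<Longrightarrow> 0 \<le> f v" and "u \<in> verts G"
  shows "0 \<le> (out_sum ^^ k) f u"
  using assms(2)
  by (induction k arbitrary: u) (auto simp: assms(1) out_sum_def intro!: sum_nonneg)

lemma norm_out_sum_pow_le:
  fixes f :: "'a \<Rightarrow> 'c::real_normed_vector"
  assumes "u \<in> verts G"
  shows "norm ((out_sum ^^ k) f u) \<le> (out_sum ^^ k) (\<lambda>v. norm (f v)) u"
  using assms
proof (induction k arbitrary: u)
  case (Suc k)
  have "norm ((out_sum ^^ Suc k) f u) \<le> out_sum (\<lambda>v. norm ((out_sum ^^ k) f v)) u"
    by (simp add: out_sum_def norm_sum)
  also have "\<dots> \<le> out_sum ((out_sum ^^ k) (\<lambda>v. norm (f v))) u"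
    by (rule out_sum_mono) (rule Suc.IH)
  finally show ?case by simp
qed simp

text \<open>A nonempty walk splits uniquely into its first arc and a shorter walk from the head of
  that arc, which is the recursion of \<open>out_sum\<close>.\<close>

lemma k_outdegree_eq_out_sum_pow:
  assumes "u \<in> verts G"
  shows "k_outdegree G k u = (out_sum ^^ k) (\<lambda>_. 1) u"
  using assms
proof (induction k arbitrary: u)
  case 0
  then have "{p. (\<exists>v. awalk u p v) \<and> length p = 0} = {[]}"
    by (auto simp: awalk_def)
  then show ?case by (simp add: k_outdegree_def)
next
  case (Suc k)
  let ?W = "\<lambda>k u. {p. (\<exists>v. awalk u p v) \<and> length p = k}"
  have fin: "finite (?W k u)" for k u
    by (rule finite_subset[OF _ finite_lists_length_eq[OF finite_arcs, of k]])
      (auto simp: awalk_def)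
  have "?W (Suc k) u = (\<Union>e\<in>out_arcs G u. (#) e ` ?W k (head G e))"
    using Suc.prems by (force simp: length_Suc_conv awalk_Cons_iff)
  moreover have "card (\<Union>e\<in>out_arcs G u. (#) e ` ?W k (head G e))
      = (\<Sum>e\<in>out_arcs G u. card ((#) e ` ?W k (head G e)))"
    by (rule card_UN_disjoint) (auto simp: fin)
  moreover have "card ((#) e ` ?W k v) = card (?W k v)" for e v
    by (rule card_image) simp
  ultimately have "k_outdegree G (Suc k) u = (\<Sum>e\<in>out_arcs G u. k_outdegree G k (head G e))"
    by (simp add: k_outdegree_def)
  also have "\<dots> = out_sum ((out_sum ^^ k) (\<lambda>_. 1)) u"
    unfolding out_sum_def[of "(out_sum ^^ k) (\<lambda>_. 1)"] by (rule sum.cong) (auto simp: Suc.IH)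
  finally show ?case by simp
qed

lemma real_out_sum_pow:
  "real ((out_sum ^^ k) f u) = (out_sum ^^ k) (\<lambda>v. real (f v)) u"
  by (induction k arbitrary: u) (simp_all add: out_sum_def)

lemma real_k_outdegree:
  "u \<in> verts G \<Longrightarrow> real (k_outdegree G k u) = (out_sum ^^ k) (\<lambda>_. 1) u"
  by (simp add: k_outdegree_eq_out_sum_pow real_out_sum_pow)

end

section \<open>The adjacency matrix\<close>

locale enumerated_digraph = fin_digraph G for G :: "('a, 'b) pre_digraph" +
  fixes vs :: "'a list"
  assumes distinct_vs: "distinct vs" and set_vs: "set vs = verts G" and verts_nonempty: "verts G \<noteq> {}"
begin

abbreviation "A \<equiv> adjacency_mat G vs"
abbreviation "\<rho> \<equiv> digraph_spectral_radius G vs"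

definition vec_of :: "('a \<Rightarrow> complex) \<Rightarrow> complex vec" where
  "vec_of f = vec (length vs) (\<lambda>i. f (vs ! i))"

definition eigenfun :: "complex \<Rightarrow> ('a \<Rightarrow> complex) \<Rightarrow> bool" where
  "eigenfun z f \<longleftrightarrow> (\<exists>v\<in>verts G. f v \<noteq> 0) \<and> (\<forall>u\<in>verts G. out_sum f u = z * f u)"

lemma A_carrier [simp]: "A \<in> carrier_mat (length vs) (length vs)"
  by (simp add: adjacency_mat_def)

lemma vs_nth [simp]: "i < length vs \<Longrightarrow> vs ! i \<in> verts G"
  unfolding set_vs[symmetric] by (rule nth_mem)

lemma bij_vs: "bij_betw ((!) vs) {..<length vs} (verts G)"
  by (rule bij_betw_nth[OF distinct_vs refl set_vs[symmetric]])

lemma length_vs_pos: "0 < length vs"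
  by (metis length_greater_0_conv list.set(1) set_vs verts_nonempty)

lemma dim_vec_of [simp]: "dim_vec (vec_of f) = length vs" "vec_of f \<in> carrier_vec (length vs)"
  by (simp_all add: vec_of_def)

lemma vec_of_eq_iff: "vec_of f = vec_of g \<longleftrightarrow> (\<forall>v\<in>verts G. f v = g v)"
proof
  assume eq: "vec_of f = vec_of g"
  have *: "f (vs ! i) = g (vs ! i)" if i: "i < length vs" for i
  proof -
    have "f (vs ! i) = vec_of f $ i" using i by (simp add: vec_of_def)
    also have "\<dots> = g (vs ! i)" unfolding eq using i by (simp add: vec_of_def)
    finally show ?thesis .
  qed
  show "\<forall>v\<in>verts G. f v = g v"
  proof
    fix v assume "v \<in> verts G"
    then obtain i where "i < length vs" "vs ! i = v" by (metis in_set_conv_nth set_vs)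
    then show "f v = g v" using * by blast
  qed
next
  assume "\<forall>v\<in>verts G. f v = g v"
  then show "vec_of f = vec_of g" by (intro eq_vecI) (simp_all add: vec_of_def)
qed

lemma vec_of_surj:
  assumes "v \<in> carrier_vec (length vs)"
  obtains f where "v = vec_of f"
proof
  show "v = vec_of (\<lambda>u. v $ the_inv_into {..<length vs} ((!) vs) u)"
    using assms bij_vs by (intro eq_vecI) (auto simp: vec_of_def bij_betw_def the_inv_into_f_f)
qed

text \<open>Grouping the arcs that leave \<open>vs ! i\<close> by their heads turns the sum over
  arcs into a matrix row, whose entries count parallel arcs.\<close>

lemma A_mult_vec_of: "A *\<^sub>v vec_of f = vec_of (out_sum f)"
proof (rule eq_vecI)
  fix i assume "i < dim_vec (vec_of (out_sum f))"
  then have i: "i < length vs" by simp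
  let ?a = "\<lambda>v. {e \<in> out_arcs G (vs ! i). head G e = v}"
  have "(A *\<^sub>v vec_of f) $ i = (\<Sum>j\<in>{..<length vs}. of_nat (card (?a (vs ! j))) * f (vs ! j))"
    using i by (simp add: adjacency_mat_def vec_of_def scalar_prod_def lessThan_atLeast0 conj_assoc)
  also have "\<dots> = (\<Sum>v\<in>verts G. of_nat (card (?a v)) * f v)"
    by (rule sum.reindex_bij_betw[OF bij_vs])
  also have "\<dots> = (\<Sum>v\<in>verts G. \<Sum>e\<in>?a v. f (head G e))"
    by (intro sum.cong) simp_all
  also have "\<dots> = out_sum f (vs ! i)"
    unfolding out_sum_def by (rule sum.group) auto
  finally show "(A *\<^sub>v vec_of f) $ i = vec_of (out_sum f) $ i"
    using i by (simp add: vec_of_def)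
qed (simp add: adjacency_mat_def)

lemma smult_vec_of: "c \<cdot>\<^sub>v vec_of f = vec_of (\<lambda>v. c * f v)"
  by (intro eq_vecI) (simp_all add: vec_of_def)

lemma eigenvector_vec_of: "eigenvector A (vec_of f) z \<longleftrightarrow> eigenfun z f"
proof -
  have zero: "0\<^sub>v (length vs) = vec_of (\<lambda>_. 0)"
    by (intro eq_vecI) (simp_all add: vec_of_def)
  show ?thesis
    unfolding eigenvector_def eigenfun_def A_mult_vec_of smult_vec_of carrier_matD[OF A_carrier] zero
      vec_of_eq_iff by simp
qed

lemma eigenvalue_iff_eigenfun: "eigenvalue A z \<longleftrightarrow> (\<exists>f. eigenfun z f)"
proof
  assume "eigenvalue A z"
  then obtain v where v: "eigenvector A v z" by (auto simp: eigenvalue_def)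
  then have "v \<in> carrier_vec (length vs)"
    by (simp add: eigenvector_def carrier_matD[OF A_carrier])
  then obtain f where "v = vec_of f" by (rule vec_of_surj)
  with v show "\<exists>f. eigenfun z f" by (auto simp: eigenvector_vec_of)
next
  assume "\<exists>f. eigenfun z f"
  then show "eigenvalue A z" unfolding eigenvalue_def eigenvector_vec_of[symmetric] by blast
qed

section \<open>The spectral radius and the growth of powers\<close>

lemma eigenvalue_le_radius: "eigenvalue A z \<Longrightarrow> cmod z \<le> \<rho>"
  unfolding digraph_spectral_radius_def
  by (rule spectral_radius_mem_max(2)[OF A_carrier length_vs_pos]) (simp add: spectrum_def)

lemma radius_attained:
  obtains z f where "eigenfun z f" "cmod z = \<rho>"
proof -
  have "\<rho> \<in> norm ` spectrum A"
    unfolding digraph_spectral_radius_def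
    by (rule spectral_radius_mem_max(1)[OF A_carrier length_vs_pos])
  then show thesis using that by (auto simp: spectrum_def eigenvalue_iff_eigenfun)
qed

lemma radius_nonneg: "0 \<le> \<rho>"
  by (rule radius_attained) (metis norm_ge_zero)

text \<open>Scaling by \<open>1 / s\<close> gives a matrix \<open>B\<close> of spectral radius below
  1, whose powers have bounded entries. Taking \<open>s\<close> strictly above \<rho> absorbs the
  polynomial factors that Jordan blocks may cause.\<close>

lemma out_sum_pow_growth:
  fixes x :: "'a \<Rightarrow> real"
  assumes s: "\<rho> < s"
  obtains C where "\<And>k u. u \<in> verts G \<Longrightarrow> \<bar>(out_sum ^^ k) x u\<bar> \<le> C * s ^ k"
proof -
  let ?n = "length vs" let ?c = "complex_of_real (1 / s)"
  have s0: "0 < s" using s radius_nonneg by linarith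
  define B where "B = ?c \<cdot>\<^sub>m A"
  have B: "B \<in> carrier_mat ?n ?n" by (simp add: B_def)
  have BA: "B *\<^sub>v vec_of f = vec_of (\<lambda>v. ?c * out_sum f v)" for f
  proof -
    have "B *\<^sub>v vec_of f = ?c \<cdot>\<^sub>v (A *\<^sub>v vec_of f)"
      unfolding B_def by (rule eq_vecI)
        (auto simp: scalar_prod_def sum_distrib_left mult.assoc carrier_matD[OF A_carrier])
    then show ?thesis by (simp only: A_mult_vec_of smult_vec_of)
  qed
  have "cmod z < 1" if ev: "eigenvalue B z" for z
  proof -
    obtain v where v: "eigenvector B v z" using ev by (auto simp: eigenvalue_def)
    then have "v \<in> carrier_vec ?n" by (simp add: eigenvector_def carrier_matD[OF B])
    then obtain f where f: "v = vec_of f" by (rule vec_of_surj)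
    have "0\<^sub>v ?n = vec_of (\<lambda>_. 0)" by (intro eq_vecI) (simp_all add: vec_of_def)
    with v f have "eigenfun (s * z) f"
      using s0 by (auto simp: eigenvector_def carrier_matD[OF B] BA smult_vec_of vec_of_eq_iff
          eigenfun_def field_simps)
    then have "cmod (s * z) \<le> \<rho>" using eigenvalue_le_radius eigenvalue_iff_eigenfun by blast
    then have "s * cmod z \<le> \<rho>" using s0 by (simp add: norm_mult)
    then have "s * cmod z < s" using s by linarith
    then show ?thesis using s0 by simp
  qed
  moreover have "spectral_radius B \<in> norm ` spectrum B"
    by (rule spectral_radius_mem_max(1)[OF B length_vs_pos])
  ultimately have "spectral_radius B < 1" by (auto simp: spectrum_def)
  from spectral_radius_jnf_norm_bound_less_1_upper_triangular[OF B this]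
  obtain c where c: "\<And>k. norm_bound (B ^\<^sub>m k) c" by blast
  have Bpow: "B ^\<^sub>m k *\<^sub>v vec_of f = vec_of (\<lambda>v. ?c ^ k * (out_sum ^^ k) f v)" for k f
  proof (induction k arbitrary: f)
    case (Suc k)
    have "B ^\<^sub>m Suc k *\<^sub>v vec_of f = B ^\<^sub>m k *\<^sub>v (B *\<^sub>v vec_of f)"
      by (simp add: assoc_mult_mat_vec[OF pow_carrier_mat[OF B] B])
    also have "\<dots> = vec_of (\<lambda>v. ?c ^ k * (?c * (out_sum ^^ k) (out_sum f) v))"
      by (simp only: BA Suc out_sum_pow_scale)
    also have "\<dots> = vec_of (\<lambda>v. ?c ^ Suc k * (out_sum ^^ Suc k) f v)"
      by (simp only: out_sum_pow_swap funpow.simps o_apply power_Suc mult.assoc mult.left_commute)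
    finally show ?case .
  qed (simp add: B_def adjacency_mat_def)
  define D where "D = c * (\<Sum>i<?n. \<bar>x (vs ! i)\<bar>)"
  show thesis
  proof
    fix k u assume "u \<in> verts G"
    then obtain i where i: "i < ?n" "u = vs ! i" by (metis in_set_conv_nth set_vs)
    let ?f = "\<lambda>v. complex_of_real (x v)"
    have dim: "dim_row (B ^\<^sub>m k) = ?n" "dim_col (B ^\<^sub>m k) = ?n"
      by (rule carrier_matD[OF pow_carrier_mat[OF B]])+
    have "cmod ((B ^\<^sub>m k *\<^sub>v vec_of ?f) $ i) \<le> (\<Sum>j<?n. cmod ((B ^\<^sub>m k) $$ (i, j) * ?f (vs ! j)))"
      using i dim by (simp add: scalar_prod_def vec_of_def lessThan_atLeast0 norm_sum)
    also have "\<dots> \<le> (\<Sum>j<?n. c * \<bar>x (vs ! j)\<bar>)"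
      using c[of k] i dim by (intro sum_mono) (auto simp: norm_bound_def norm_mult intro!: mult_right_mono)
    finally have "cmod (?c ^ k * (out_sum ^^ k) ?f u) \<le> D"
      using i by (simp add: Bpow D_def sum_distrib_left) (simp add: vec_of_def)
    then have "\<bar>(out_sum ^^ k) x u\<bar> / s ^ k \<le> D"
      using s0 by (simp add: out_sum_pow_of_real norm_mult norm_power norm_divide power_one_over)
    then show "\<bar>(out_sum ^^ k) x u\<bar> \<le> D * s ^ k"
      using s0 by (simp add: divide_le_eq)
  qed
qed

end

section \<open>Generalized eigenfunctions and Collatz--Wielandt bounds\<close>

lemma square_dvd_of_order_ge_2:
  assumes "Polynomial.order z p \<ge> 2"
  shows "[:- z, 1:] ^ 2 dvd p"
  using assms by (meson dvd_trans le_imp_power_dvd order_1)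

context enumerated_digraph
begin

text \<open>In a Schur triangulation \<open>A = P * B * Q\<close> a double root can occupy the first
  two diagonal places, and the first two columns of \<open>P\<close> then serve as \<open>f\<close>
  and \<open>g\<close>. The scalar \<open>b\<close> covers both cases: two independent eigenvectors
  if it is 0, a Jordan chain otherwise.\<close>

lemma double_root_generalized_eigenfuns:
  assumes "2 \<le> Polynomial.order z (char_poly A)"
  obtains f g b where
    "\<And>u. u \<in> verts G \<Longrightarrow> out_sum f u = z * f u"
    "\<And>u. u \<in> verts G \<Longrightarrow> out_sum g u = z * g u + b * f u"
    "\<And>c d. (\<And>v. v \<in> verts G \<Longrightarrow> c * f v + d * g v = 0) \<Longrightarrow> c = 0 \<and> d = 0"
proof -
  let ?n = "length vs"
  let ?p = "char_poly A"
  obtain q where q: "?p = [:- z, 1:] ^ 2 * q"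
    using square_dvd_of_order_ge_2[OF assms] by (rule dvdE)
  have monic_p: "degree ?p = ?n" "lead_coeff ?p = 1"
    using degree_monic_char_poly[OF A_carrier] by auto
  have "lead_coeff ?p = lead_coeff q"
    unfolding q by (simp add: lead_coeff_mult lead_coeff_power)
  then have "lead_coeff q = 1" using monic_p by simp
  moreover obtain as where "Polynomial.smult (lead_coeff q) (\<Prod>a\<leftarrow>as. [:- a, 1:]) = q"
    using fundamental_theorem_algebra_factorized[of q] by blast
  ultimately have as: "q = (\<Prod>a\<leftarrow>as. [:- a, 1:])" by simp
  \<comment> \<open>\<open>schur_decomposition\<close> keeps the order of the listed roots, so the
    two leading copies of \<open>z\<close> become the entries 0 and 1 of the diagonal of
    \<open>B\<close>.\<close>
  have p: "?p = (\<Prod>e\<leftarrow>z # z # as. [:- e, 1:])"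
    by (simp add: q as power2_eq_square mult.assoc del: mult_pCons_left mult_pCons_right)
  obtain B P Q where BPQ: "schur_decomposition A (z # z # as) = (B, P, Q)"
    by (cases "schur_decomposition A (z # z # as)")
  have sim: "similar_mat_wit A B P Q" and ut: "upper_triangular B" and diag: "diag_mat B = z # z # as"
    using schur_decomposition[OF A_carrier p BPQ] by auto
  have PQ: "P * Q = 1\<^sub>m ?n" "Q * P = 1\<^sub>m ?n" "A = P * B * Q"
    and B: "B \<in> carrier_mat ?n ?n" and P: "P \<in> carrier_mat ?n ?n" and Q: "Q \<in> carrier_mat ?n ?n"
    using similar_mat_witD2[OF A_carrier sim] by auto
  have "length (diag_mat B) = ?n" using B by (simp add: diag_mat_def)
  then have n2: "2 \<le> ?n" by (simp add: diag)
  have diag_nth: "B $$ (i, i) = (z # z # as) ! i" if "i < ?n" for i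
    using that B by (simp add: diag_mat_def flip: diag)
  have B00: "B $$ (0, 0) = z" and B11: "B $$ (1, 1) = z"
    using n2 length_vs_pos diag_nth[of 0] diag_nth[of 1] by auto
  have AP: "A * P = P * B"
  proof -
    have PB: "P * B \<in> carrier_mat ?n ?n" using P B by (rule mult_carrier_mat)
    show ?thesis
      unfolding PQ(3) assoc_mult_mat[OF PB Q P] PQ(2) by (rule right_mult_one_mat[OF PB])
  qed
  let ?e0 = "unit_vec ?n 0 :: complex vec" and ?e1 = "unit_vec ?n (Suc 0) :: complex vec"
  have Bu: "(B *\<^sub>v unit_vec ?n j) $ i = B $$ (i, j)" if "i < ?n" "j < ?n" for i j
    using that B by (simp add: scalar_prod_right_unit[of _ ?n])
  have Be0: "B *\<^sub>v ?e0 = z \<cdot>\<^sub>v ?e0"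
  proof (rule eq_vecI)
    fix i assume "i < dim_vec (z \<cdot>\<^sub>v ?e0)"
    then have i: "i < ?n" by simp
    then have "B $$ (i, 0) = (if i = 0 then z else 0)"
      using B00 upper_triangularD[OF ut, of 0 i] B by auto
    then show "(B *\<^sub>v ?e0) $ i = (z \<cdot>\<^sub>v ?e0) $ i" using i n2 length_vs_pos by (auto simp: Bu)
  qed (use B in auto)
  define b where "b = B $$ (0, 1)"
  have Be1: "B *\<^sub>v ?e1 = z \<cdot>\<^sub>v ?e1 + b \<cdot>\<^sub>v ?e0"
  proof (rule eq_vecI)
    fix i assume "i < dim_vec (z \<cdot>\<^sub>v ?e1 + b \<cdot>\<^sub>v ?e0)"
    then have i: "i < ?n" by simp
    then have "B $$ (i, 1) = (if i = 0 then b else if i = 1 then z else 0)"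
      using B11 upper_triangularD[OF ut, of 1 i] B by (auto simp: b_def)
    then show "(B *\<^sub>v ?e1) $ i = (z \<cdot>\<^sub>v ?e1 + b \<cdot>\<^sub>v ?e0) $ i" using i n2 length_vs_pos by (auto simp: Bu)
  qed (use B in auto)
  have Pe: "P *\<^sub>v unit_vec ?n i \<in> carrier_vec ?n" for i using P by auto
  obtain f where f: "P *\<^sub>v ?e0 = vec_of f" using Pe by (rule vec_of_surj)
  obtain g where g: "P *\<^sub>v ?e1 = vec_of g" using Pe by (rule vec_of_surj)
  have AP_mult: "A *\<^sub>v (P *\<^sub>v v) = P *\<^sub>v (B *\<^sub>v v)" if "v \<in> carrier_vec ?n" for v
    using that AP assoc_mult_mat_vec[OF A_carrier P that] assoc_mult_mat_vec[OF P B that] by simp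
  have add: "vec_of f + vec_of g = vec_of (\<lambda>v. f v + g v)" for f g
    by (intro eq_vecI) (simp_all add: vec_of_def)
  have "vec_of (out_sum f) = vec_of (\<lambda>v. z * f v)"
    using AP_mult[of ?e0] P unfolding Be0
    by (simp add: f A_mult_vec_of mult_mat_vec[of _ ?n ?n] smult_vec_of)
  then have f1: "\<And>u. u \<in> verts G \<Longrightarrow> out_sum f u = z * f u" by (simp add: vec_of_eq_iff)
  have "vec_of (out_sum g) = vec_of (\<lambda>v. z * g v + b * f v)"
    using AP_mult[of ?e1] P unfolding Be1
    by (simp add: f g A_mult_vec_of mult_mat_vec[of _ ?n ?n] smult_vec_of
        mult_add_distrib_mat_vec[of _ ?n ?n] add)
  then have g1: "\<And>u. u \<in> verts G \<Longrightarrow> out_sum g u = z * g u + b * f u" by (simp add: vec_of_eq_iff)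
  have indep: "c = 0 \<and> d = 0" if 0: "\<And>v. v \<in> verts G \<Longrightarrow> c * f v + d * g v = 0" for c d
  proof -
    have "P *\<^sub>v (c \<cdot>\<^sub>v ?e0 + d \<cdot>\<^sub>v ?e1) = vec_of (\<lambda>v. c * f v + d * g v)"
      using P by (simp add: f g mult_mat_vec[of _ ?n ?n] smult_vec_of
          mult_add_distrib_mat_vec[of _ ?n ?n] add)
    also have "\<dots> = 0\<^sub>v ?n" using 0 by (intro eq_vecI) (simp_all add: vec_of_def)
    finally have "Q *\<^sub>v (P *\<^sub>v (c \<cdot>\<^sub>v ?e0 + d \<cdot>\<^sub>v ?e1)) = Q *\<^sub>v 0\<^sub>v ?n" by simp
    also have "\<dots> = 0\<^sub>v ?n" using Q by (intro eq_vecI) (auto simp: scalar_prod_def)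
    finally have "Q *\<^sub>v (P *\<^sub>v (c \<cdot>\<^sub>v ?e0 + d \<cdot>\<^sub>v ?e1)) = 0\<^sub>v ?n" .
    moreover have "Q *\<^sub>v (P *\<^sub>v v) = v" if "v \<in> carrier_vec ?n" for v
      using that assoc_mult_mat_vec[OF Q P that] PQ by simp
    ultimately have e: "c \<cdot>\<^sub>v ?e0 + d \<cdot>\<^sub>v ?e1 = 0\<^sub>v ?n" by simp
    have "(c \<cdot>\<^sub>v ?e0 + d \<cdot>\<^sub>v ?e1) $ 0 = c" "(c \<cdot>\<^sub>v ?e0 + d \<cdot>\<^sub>v ?e1) $ Suc 0 = d"
      using n2 length_vs_pos by auto
    then show ?thesis unfolding e using n2 length_vs_pos by auto
  qed
  show thesis by (rule that[of f g b]) (fact f1 g1 indep)+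
qed

text \<open>Otherwise some \<open>s\<close> lies strictly between \<rho> and
  \<open>root L m\<close>. Iterating the hypothesis makes \<open>A^(L j) x\<close> at least
  \<open>m^j x\<close>, while the growth bound allows only a multiple of
  \<open>s^(L j)\<close>.\<close>

lemma pow_ge_imp_le_radius:
  fixes x :: "'a \<Rightarrow> real"
  assumes pos: "\<And>v. v \<in> verts G \<Longrightarrow> 0 < x v"
    and ge: "\<And>v. v \<in> verts G \<Longrightarrow> m * x v \<le> (out_sum ^^ L) x v"
    and "0 \<le> m" "0 < L"
  shows "m \<le> \<rho> ^ L"
proof (rule ccontr)
  assume "\<not> m \<le> \<rho> ^ L"
  then have less: "\<rho> ^ L < m" by simp
  define t where "t = root L m"
  have "root L (\<rho> ^ L) < t" unfolding t_def using less \<open>0 < L\<close> by simp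
  then have "\<rho> < t" using \<open>0 < L\<close> radius_nonneg by (simp add: real_root_power_cancel)
  then obtain s where s: "\<rho> < s" "s < t" using dense by blast
  then have s0: "0 < s" using radius_nonneg by linarith
  obtain C where C: "\<And>k u. u \<in> verts G \<Longrightarrow> \<bar>(out_sum ^^ k) x u\<bar> \<le> C * s ^ k"
    using s(1) by (rule out_sum_pow_growth) blast
  have low: "m ^ j * x v \<le> (out_sum ^^ (L * j)) x v" if "v \<in> verts G" for j v
    using that
  proof (induction j arbitrary: v)
    case (Suc j)
    have "m ^ Suc j * x v = m ^ j * (m * x v)" by simp
    also have "\<dots> \<le> m ^ j * (out_sum ^^ L) x v"
      using ge[OF Suc.prems] \<open>0 \<le> m\<close> by (intro mult_left_mono) auto
    also have "\<dots> = (out_sum ^^ L) (\<lambda>v. m ^ j * x v) v" by (simp only: out_sum_pow_scale)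
    also have "\<dots> \<le> (out_sum ^^ L) ((out_sum ^^ (L * j)) x) v"
      by (rule out_sum_pow_mono) (use Suc in auto)
    also have "\<dots> = (out_sum ^^ (L * Suc j)) x v" by (simp add: funpow_add)
    finally show ?case .
  qed simp
  obtain v where v: "v \<in> verts G" using verts_nonempty by blast
  have m: "m = t ^ L" using \<open>0 < L\<close> \<open>0 \<le> m\<close> by (simp add: t_def)
  \<comment> \<open>Both growth estimates together keep \<open>q ^ j * x v\<close> below
    \<open>C\<close> for every \<open>j\<close>, although \<open>q\<close> exceeds 1.\<close>
  define q where "q = (t / s) ^ L"
  have "1 < q" unfolding q_def using s s0 \<open>0 < L\<close> by (intro one_less_power) simp_all
  have "q ^ j * x v \<le> C" for j
  proof -
    have "m ^ j * x v \<le> C * (s ^ L) ^ j"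
      using low[OF v, of j] C[OF v, of "L * j"] by (simp add: power_mult)
    then show ?thesis using s0 by (simp add: q_def m power_divide field_simps)
  qed
  moreover obtain j where "C / x v < q ^ j" using real_arch_pow[OF \<open>1 < q\<close>] by blast
  ultimately show False using pos[OF v] by (metis linorder_not_less pos_divide_less_eq)
qed

lemma norm_eigenfun_pow_le:
  fixes x :: "'a \<Rightarrow> real"
  assumes "\<And>v. v \<in> verts G \<Longrightarrow> cmod (f v) \<le> t * x v" and "u \<in> verts G"
  shows "cmod ((out_sum ^^ k) f u) \<le> t * (out_sum ^^ k) x u"
proof -
  have "cmod ((out_sum ^^ k) f u) \<le> (out_sum ^^ k) (\<lambda>v. cmod (f v)) u"
    using assms(2) by (rule norm_out_sum_pow_le)
  also have "\<dots> \<le> (out_sum ^^ k) (\<lambda>v. t * x v) u"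
    using assms by (intro out_sum_pow_mono)
  finally show ?thesis by (simp only: out_sum_pow_scale)
qed

text \<open>\<open>t\<close> is the maximum of \<open>cmod (f v) / x v\<close> over the finite
  vertex set, and \<open>u\<close> a vertex where it is attained.\<close>

lemma tight_bound_by_positive:
  fixes x :: "'a \<Rightarrow> real" and f :: "'a \<Rightarrow> complex"
  assumes pos: "\<And>v. v \<in> verts G \<Longrightarrow> 0 < x v"
  obtains t u where "u \<in> verts G" "cmod (f u) = t * x u"
    "\<And>v. v \<in> verts G \<Longrightarrow> cmod (f v) \<le> t * x v"
proof -
  let ?R = "(\<lambda>v. cmod (f v) / x v) ` verts G"
  have "Max ?R \<in> ?R" using verts_nonempty by (intro Max_in) auto
  then obtain u where u: "u \<in> verts G" "Max ?R = cmod (f u) / x u" by auto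
  show thesis
  proof
    show "u \<in> verts G" by fact
    show "cmod (f u) = Max ?R * x u" using u pos[OF u(1)] by simp
    fix v assume v: "v \<in> verts G"
    then have "cmod (f v) / x v \<le> Max ?R" by (intro Max_ge) auto
    then show "cmod (f v) \<le> Max ?R * x v" using pos[OF v] by (simp add: divide_le_eq)
  qed
qed

text \<open>For an eigenfunction \<open>f\<close> of modulus \<rho>, take the vertex where its
  modulus touches \<open>t x\<close>. There \<open>\<rho>^L t x\<close> is the modulus of
  \<open>A^L f\<close>, hence at most \<open>t A^L x\<close> and so at most \<open>t m x\<close>;
  the positive factor \<open>t x\<close> cancels.\<close>

lemma pow_le_imp_radius_le:
  fixes x :: "'a \<Rightarrow> real"
  assumes pos: "\<And>v. v \<in> verts G \<Longrightarrow> 0 < x v"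
    and le: "\<And>v. v \<in> verts G \<Longrightarrow> (out_sum ^^ L) x v \<le> m * x v"
  shows "\<rho> ^ L \<le> m"
proof -
  obtain z f where f: "eigenfun z f" and z: "cmod z = \<rho>" by (rule radius_attained)
  obtain t u where u: "u \<in> verts G" "cmod (f u) = t * x u"
    and bound: "\<And>v. v \<in> verts G \<Longrightarrow> cmod (f v) \<le> t * x v"
    using pos by (rule tight_bound_by_positive[where f = f]) blast+
  obtain v where v: "v \<in> verts G" "f v \<noteq> 0" using f by (auto simp: eigenfun_def)
  have "0 < cmod (f v)" using v by simp
  also have "\<dots> \<le> t * x v" by (rule bound) fact
  finally have t: "0 < t" using pos[OF v(1)] by (simp add: zero_less_mult_iff)
  have "(out_sum ^^ (1 * L)) f u = z ^ L * f u"
    using f u by (intro out_sum_pow_eigen) (auto simp: eigenfun_def)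
  then have "\<rho> ^ L * (t * x u) = cmod ((out_sum ^^ L) f u)"
    using u z by (simp add: norm_mult norm_power)
  also have "\<dots> \<le> t * (out_sum ^^ L) x u" using bound u(1) by (rule norm_eigenfun_pow_le)
  also have "\<dots> \<le> t * (m * x u)" using le[OF u(1)] t by simp
  finally have "\<rho> ^ L * (t * x u) \<le> m * (t * x u)" by (simp add: mult_ac)
  then show ?thesis using t pos[OF u(1)] by (simp add: mult_le_cancel_right)
qed

end

section \<open>Strong connectivity and cyclic partitions\<close>

context fin_digraph
begin

lemma strongly_connected_induct:
  assumes "strongly_connected G" "u \<in> verts G" "v \<in> verts G" "P u"
    and step: "\<And>e. e \<in> arcs G \<Longrightarrow> P (tail G e) \<Longrightarrow> P (head G e)"
  shows "P v"
proof -
  have "u \<rightarrow>\<^sup>* v" using assms by (auto simp: strongly_connected_def)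
  then show ?thesis
  proof (induction rule: reachable_induct)
    case (step x y)
    then show ?case using assms(5) by (auto simp: arcs_ends_conv)
  qed (use assms in auto)
qed

section \<open>Positivity along walks\<close>

lemma term_le_out_sum:
  fixes f :: "'a \<Rightarrow> real"
  assumes "e \<in> arcs G" "\<And>v. v \<in> verts G \<Longrightarrow> 0 \<le> f v"
  shows "f (head G e) \<le> out_sum f (tail G e)"
  unfolding out_sum_def using assms by (intro member_le_sum) auto

lemma out_sum_pow_pos:
  fixes x :: "'a \<Rightarrow> real"
  assumes "\<forall>u\<in>verts G. \<not> is_sink G u" "\<And>v. v \<in> verts G \<Longrightarrow> 0 < x v" "u \<in> verts G"
  shows "0 < (out_sum ^^ k) x u"
  using assms(3)
proof (induction k arbitrary: u)
  case (Suc k)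
  then have "out_arcs G u \<noteq> {}" using assms(1) by (auto simp: is_sink_def out_degree_def)
  then show ?case using Suc by (auto simp: out_sum_def intro!: sum_pos)
qed (simp add: assms)

lemma out_sum_pow_commute: "(out_sum ^^ k) ((out_sum ^^ l) f) = (out_sum ^^ l) ((out_sum ^^ k) f)"
  by (metis add.commute comp_apply funpow_add)

text \<open>A walk of length \<open>k\<close> from \<open>u\<close> to \<open>w\<close> makes
  \<open>A^k g\<close> positive at \<open>u\<close>. A single length need not serve all vertices
  when the digraph is periodic, so all lengths below a common \<open>N\<close> are summed.\<close>

lemma eventually_reached:
  fixes g :: "'a \<Rightarrow> real"
  assumes "strongly_connected G" "w \<in> verts G" "0 < g w"
    and nonneg: "\<And>v. v \<in> verts G \<Longrightarrow> 0 \<le> g v"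
  obtains N where "\<And>u. u \<in> verts G \<Longrightarrow> 0 < (\<Sum>s<N. (out_sum ^^ s) g u)"
proof -
  have "\<exists>k. 0 < (out_sum ^^ k) g u" if "u \<in> verts G" for u
  proof -
    have "u \<rightarrow>\<^sup>* w" using assms that by (auto simp: strongly_connected_def)
    then show ?thesis
    proof (induction rule: converse_reachable_induct)
      case base
      have "0 < (out_sum ^^ 0) g w" using assms by simp
      then show ?case by blast
    next
      case (step x y)
      then obtain k e where k: "0 < (out_sum ^^ k) g y" and e: "e \<in> arcs G" "tail G e = x" "head G e = y"
        by (auto simp: arcs_ends_conv)
      have "(out_sum ^^ k) g y \<le> (out_sum ^^ Suc k) g x"
        using term_le_out_sum[OF e(1), of "(out_sum ^^ k) g"] out_sum_pow_nonneg[where k = k, OF nonneg] e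
        by simp
      with k have "0 < (out_sum ^^ Suc k) g x" by linarith
      then show ?case by blast
    qed
  qed
  then obtain k where k: "\<And>u. u \<in> verts G \<Longrightarrow> 0 < (out_sum ^^ k u) g u" by metis
  show thesis
  proof
    fix u assume u: "u \<in> verts G"
    then have "k u \<le> Max (k ` verts G)" by (intro Max_ge) auto
    then have "k u \<in> {..<Suc (Max (k ` verts G))}" by (simp only: lessThan_iff less_Suc_eq_le)
    then show "0 < (\<Sum>s<Suc (Max (k ` verts G)). (out_sum ^^ s) g u)"
      by (rule sum_pos2[OF finite_lessThan]) (use k u nonneg in \<open>auto intro!: out_sum_pow_nonneg\<close>)
  qed
qed

text \<open>Summing over initial walks spreads a defect at a single vertex to every vertex.\<close>

lemma spread_defect:
  fixes x g :: "'a \<Rightarrow> real"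
  assumes "strongly_connected G" "w \<in> verts G" "0 < g w"
    and nonneg: "\<And>v. v \<in> verts G \<Longrightarrow> 0 \<le> g v" and pos: "\<And>v. v \<in> verts G \<Longrightarrow> 0 < x v"
  obtains N \<epsilon> where "0 < \<epsilon>" "\<And>u. u \<in> verts G \<Longrightarrow> 0 < (\<Sum>s<N. (out_sum ^^ s) x u)"
    "\<And>u. u \<in> verts G \<Longrightarrow> \<epsilon> * (\<Sum>s<N. (out_sum ^^ s) x u) \<le> (\<Sum>s<N. (out_sum ^^ s) g u)"
proof -
  obtain N where N: "\<And>u. u \<in> verts G \<Longrightarrow> 0 < (\<Sum>s<N. (out_sum ^^ s) g u)"
    using eventually_reached[of w g, OF assms(1-3) nonneg] by blast
  let ?x = "\<lambda>u. \<Sum>s<N. (out_sum ^^ s) x u" and ?g = "\<lambda>u. \<Sum>s<N. (out_sum ^^ s) g u"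
  have "N \<noteq> 0" using N[OF assms(2)] by (intro notI) simp
  have x: "0 < ?x u" if "u \<in> verts G" for u
    using that pos \<open>N \<noteq> 0\<close>
    by (intro sum_pos2[of _ 0]) (auto intro!: out_sum_pow_nonneg intro: less_imp_le)
  define \<epsilon> where "\<epsilon> = Min ((\<lambda>u. ?g u / ?x u) ` verts G)"
  have "\<epsilon> \<in> (\<lambda>u. ?g u / ?x u) ` verts G"
    unfolding \<epsilon>_def using assms(2) by (intro Min_in) auto
  then have "0 < \<epsilon>" using x N by auto
  moreover have "\<epsilon> * ?x u \<le> ?g u" if "u \<in> verts G" for u
  proof -
    have "\<epsilon> \<le> ?g u / ?x u" unfolding \<epsilon>_def using that by (intro Min_le) auto
    then show ?thesis using x[OF that] by (simp add: le_divide_eq)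
  qed
  ultimately show thesis using x that by blast
qed

lemma out_sum_pow_spread:
  "(out_sum ^^ L) (\<lambda>v. \<Sum>s<N. (out_sum ^^ s) x v) u = (\<Sum>s<N. (out_sum ^^ s) ((out_sum ^^ L) x) u)"
  by (simp only: out_sum_pow_sum out_sum_pow_commute[of L])

text \<open>One application of the operator shifts the terms by one index and multiplies by
  \<open>c\<close>; the hypothesis on \<open>f\<close> makes the term at \<open>L\<close> equal to
  the term at 0, so the shift leaves the sum unchanged. Taking \<open>c\<close> to be \<rho>
  produces the Perron vector, taking \<open>\<rho> \<theta>\<close> the Fourier components.\<close>

lemma out_sum_pow_resolvent:
  fixes f :: "'a \<Rightarrow> 'c::field"
  assumes "c \<noteq> 0" and f: "\<And>v. v \<in> verts G \<Longrightarrow> (out_sum ^^ L) f v = c ^ L * f v" and "u \<in> verts G"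
  shows "out_sum (\<lambda>v. \<Sum>s<L. (1 / c) ^ s * (out_sum ^^ s) f v) u
    = c * (\<Sum>s<L. (1 / c) ^ s * (out_sum ^^ s) f u)"
proof -
  define a where "a s = (1 / c) ^ s * (out_sum ^^ s) f u" for s
  have "a L = a 0" using f[OF \<open>u \<in> verts G\<close>] \<open>c \<noteq> 0\<close> by (simp add: a_def power_one_over)
  then have shift: "(\<Sum>s<L. a (Suc s)) = (\<Sum>s<L. a s)"
    using sum.lessThan_Suc_shift[of a L] sum.lessThan_Suc[of a L] by simp
  have "out_sum (\<lambda>v. \<Sum>s<L. (1 / c) ^ s * (out_sum ^^ s) f v) u = (\<Sum>s<L. c * a (Suc s))"
    using \<open>c \<noteq> 0\<close> by (simp add: out_sum_sum out_sum_scale a_def)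
  also have "\<dots> = c * (\<Sum>s<L. a s)" by (simp only: shift flip: sum_distrib_left)
  finally show ?thesis by (simp only: a_def)
qed

text \<open>Every arc leads to the next class, so each step contributes the constant of the next
  class. The form \<open>i mod r + 1\<close> adapts a zero-based counter to the class numbers
  \<open>1..r\<close>.\<close>

lemma cyclic_out_sum_pow:
  fixes x :: "'a \<Rightarrow> real"
  assumes V: "cyclic_partition G r V" and "1 \<le> r"
    and c: "\<And>j u. j \<in> {1..r} \<Longrightarrow> u \<in> V j \<Longrightarrow> out_sum x u = c j * x u"
    and u: "u \<in> V (i mod r + 1)"
  shows "(out_sum ^^ m) x u = (\<Prod>s<m. c ((i + s) mod r + 1)) * x u"
  using u
proof (induction m arbitrary: i u)
  case (Suc m)
  have j: "i mod r + 1 \<in> {1..r}" using \<open>1 \<le> r\<close> by (auto simp: Suc_le_eq)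
  let ?p = "\<Prod>s<m. c ((Suc i + s) mod r + 1)"
  have "(out_sum ^^ m) x (head G e) = ?p * x (head G e)" if "e \<in> out_arcs G u" for e
  proof (rule Suc.IH)
    have "head G e \<in> V ((i mod r + 1) mod r + 1)"
      using V that Suc.prems j by (auto simp: cyclic_partition_def)
    then show "head G e \<in> V (Suc i mod r + 1)" by (simp add: mod_Suc_eq)
  qed
  then have "(out_sum ^^ Suc m) x u = ?p * out_sum x u"
    by (simp add: out_sum_def[of "(out_sum ^^ m) x"] out_sum_def[of x] sum_distrib_left)
  also have "\<dots> = (\<Prod>s<Suc m. c ((i + s) mod r + 1)) * x u"
    using c[OF j Suc.prems] by (simp add: prod.lessThan_Suc_shift del: prod.lessThan_Suc)
  finally show ?case .
qed simp

text \<open>As \<open>r\<close> divides \<open>L\<close>, a run of \<open>L\<close> consecutive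
  classes meets each class equally often, so the product of constants does not depend on the
  starting class.\<close>

lemma cyclic_out_sum_pow_period:
  fixes x :: "'a \<Rightarrow> real"
  assumes V: "cyclic_partition G r V" and "1 \<le> r" and "r dvd L"
    and c: "\<And>j u. j \<in> {1..r} \<Longrightarrow> u \<in> V j \<Longrightarrow> out_sum x u = c j * x u"
    and pos: "\<And>j. j \<in> {1..r} \<Longrightarrow> 0 < c j"
  obtains C where "\<And>u. u \<in> verts G \<Longrightarrow> (out_sum ^^ L) x u = C * x u"
proof
  define d where "d i = c (i mod r + 1)" for i
  define P where "P i = (\<Prod>s<L. d (i + s))" for i
  have j: "i mod r + 1 \<in> {1..r}" for i using \<open>1 \<le> r\<close> by (auto simp: Suc_le_eq)
  \<comment> \<open>Moving the window by one place trades the factor \<open>d i\<close> for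
    \<open>d (i + L)\<close>, which is equal to it and positive.\<close>
  have "P (Suc i) = P i" for i
  proof -
    have "d (i + L) = d i" using \<open>r dvd L\<close> by (auto simp: d_def)
    then have "P i * d i = d i * P (Suc i)"
      using prod.lessThan_Suc_shift[of "\<lambda>s. d (i + s)" L] prod.lessThan_Suc[of "\<lambda>s. d (i + s)" L]
      by (simp add: P_def)
    moreover have "0 < d i" using pos j by (simp add: d_def)
    ultimately show ?thesis by simp
  qed
  then have P: "P i = P 0" for i by (induction i) simp_all
  fix u assume "u \<in> verts G"
  then have "u \<in> (\<Union>j\<in>{1..r}. V j)" using V by (simp only: cyclic_partition_def)
  then obtain j where "j \<in> {1..r}" "u \<in> V j" by blast
  then have "u \<in> V ((j - 1) mod r + 1)" by auto
  with V \<open>1 \<le> r\<close> c have "(out_sum ^^ L) x u = P (j - 1) * x u"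
    unfolding P_def d_def by (rule cyclic_out_sum_pow)
  then show "(out_sum ^^ L) x u = P 0 * x u" by (simp only: P[of "j - 1"])
qed

end

section \<open>Strict comparison with the spectral radius under strong connectivity\<close>

context enumerated_digraph
begin

text \<open>Powers of \<open>A\<close> commute, so spreading the defect \<open>A^L x - m x\<close>
  shows that the summed vector satisfies the inequality with \<open>m + \<epsilon>\<close> in place
  of \<open>m\<close>; the non-strict bound applies to that vector.\<close>

lemma pow_ge_strict_imp_less_radius:
  fixes x :: "'a \<Rightarrow> real"
  assumes "strongly_connected G" and pos: "\<And>v. v \<in> verts G \<Longrightarrow> 0 < x v"
    and ge: "\<And>v. v \<in> verts G \<Longrightarrow> m * x v \<le> (out_sum ^^ L) x v"
    and "0 \<le> m" "0 < L" and w: "w \<in> verts G" "m * x w < (out_sum ^^ L) x w"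
  shows "m < \<rho> ^ L"
proof -
  let ?g = "\<lambda>v. (out_sum ^^ L) x v - m * x v"
  have gw: "0 < ?g w" and gn: "\<And>v. v \<in> verts G \<Longrightarrow> 0 \<le> ?g v"
    using w ge by simp_all
  show ?thesis
  proof (rule spread_defect[of w ?g x, OF assms(1) w(1) gw gn pos])
    fix N \<epsilon> assume \<epsilon>: "0 < \<epsilon>" and x': "\<And>u. u \<in> verts G \<Longrightarrow> 0 < (\<Sum>s<N. (out_sum ^^ s) x u)"
      and le: "\<And>u. u \<in> verts G \<Longrightarrow> \<epsilon> * (\<Sum>s<N. (out_sum ^^ s) x u) \<le> (\<Sum>s<N. (out_sum ^^ s) ?g u)"
    have "m + \<epsilon> \<le> \<rho> ^ L"
    proof (rule pow_ge_imp_le_radius[OF x'])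
      fix v assume v: "v \<in> verts G"
      have "(\<Sum>s<N. (out_sum ^^ s) ?g v)
          = (out_sum ^^ L) (\<lambda>v. \<Sum>s<N. (out_sum ^^ s) x v) v - m * (\<Sum>s<N. (out_sum ^^ s) x v)"
        by (simp only: out_sum_pow_diff out_sum_pow_scale sum_subtractf out_sum_pow_spread sum_distrib_left)
      with le[OF v] show "(m + \<epsilon>) * (\<Sum>s<N. (out_sum ^^ s) x v)
          \<le> (out_sum ^^ L) (\<lambda>v. \<Sum>s<N. (out_sum ^^ s) x v) v"
        by (simp only: distrib_right)
    qed (use assms \<epsilon> in auto)
    with \<epsilon> show ?thesis by linarith
  qed
qed

text \<open>Spreading the defect \<open>m x - A^L x\<close> lowers the constant to
  \<open>m - \<epsilon>\<close>, and the non-strict upper bound applies.\<close>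

lemma pow_le_strict_imp_radius_less:
  fixes x :: "'a \<Rightarrow> real"
  assumes "strongly_connected G" and pos: "\<And>v. v \<in> verts G \<Longrightarrow> 0 < x v"
    and le: "\<And>v. v \<in> verts G \<Longrightarrow> (out_sum ^^ L) x v \<le> m * x v"
    and w: "w \<in> verts G" "(out_sum ^^ L) x w < m * x w"
  shows "\<rho> ^ L < m"
proof -
  let ?g = "\<lambda>v. m * x v - (out_sum ^^ L) x v"
  have gw: "0 < ?g w" and gn: "\<And>v. v \<in> verts G \<Longrightarrow> 0 \<le> ?g v"
    using w le by simp_all
  show ?thesis
  proof (rule spread_defect[of w ?g x, OF assms(1) w(1) gw gn pos])
    fix N \<epsilon> assume \<epsilon>: "0 < \<epsilon>" and x': "\<And>u. u \<in> verts G \<Longrightarrow> 0 < (\<Sum>s<N. (out_sum ^^ s) x u)"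
      and le: "\<And>u. u \<in> verts G \<Longrightarrow> \<epsilon> * (\<Sum>s<N. (out_sum ^^ s) x u) \<le> (\<Sum>s<N. (out_sum ^^ s) ?g u)"
    have "\<rho> ^ L \<le> m - \<epsilon>"
    proof (rule pow_le_imp_radius_le[OF x'])
      fix v assume v: "v \<in> verts G"
      have "(\<Sum>s<N. (out_sum ^^ s) ?g v)
          = m * (\<Sum>s<N. (out_sum ^^ s) x v) - (out_sum ^^ L) (\<lambda>v. \<Sum>s<N. (out_sum ^^ s) x v) v"
        by (simp only: out_sum_pow_diff out_sum_pow_scale sum_subtractf out_sum_pow_spread sum_distrib_left)
      with le[OF v] show "(out_sum ^^ L) (\<lambda>v. \<Sum>s<N. (out_sum ^^ s) x v) v
          \<le> (m - \<epsilon>) * (\<Sum>s<N. (out_sum ^^ s) x v)"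
        by (simp only: left_diff_distrib)
    qed
    with \<epsilon> show ?thesis by linarith
  qed
qed

end

section \<open>The peripheral spectrum\<close>

text \<open>The abelian proof of Lagrange's theorem: multiplication by \<open>x\<close> permutes
  \<open>S\<close>, and the product over \<open>S\<close> is nonzero and can be cancelled.\<close>

lemma finite_mult_closed_pow_card:
  fixes S :: "'c::field set"
  assumes "finite S" "0 \<notin> S" and closed: "\<And>x y. x \<in> S \<Longrightarrow> y \<in> S \<Longrightarrow> x * y \<in> S" and "x \<in> S"
  shows "x ^ card S = 1"
proof -
  have inj: "inj_on ((*) x) S" using assms by (auto intro!: inj_onI)
  have "(*) x ` S = S"
    using assms by (intro endo_inj_surj inj) auto
  then have "\<Prod>S = (\<Prod>y\<in>S. x * y)"
    using prod.reindex[OF inj, of id] by simp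
  also have "\<dots> = x ^ card S * \<Prod>S" by (simp add: prod.distrib)
  finally show ?thesis using assms by (simp add: prod_zero_iff)
qed

text \<open>One inclusion is the previous lemma; equality follows because there are exactly
  \<open>card S\<close> such roots of unity.\<close>

lemma finite_mult_closed_eq_roots_unity:
  fixes S :: "complex set"
  assumes "finite S" "0 \<notin> S" "S \<noteq> {}" "\<And>x y. x \<in> S \<Longrightarrow> y \<in> S \<Longrightarrow> x * y \<in> S"
  shows "S = {z. z ^ card S = 1}"
proof (rule card_subset_eq)
  have "0 < card S" using assms by (simp add: card_gt_0_iff)
  then show "finite {z::complex. z ^ card S = 1}" "card S = card {z::complex. z ^ card S = 1}"
    by (simp_all add: finite_roots_unity card_roots_unity_eq)
  show "S \<subseteq> {z. z ^ card S = 1}"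
    using finite_mult_closed_pow_card[OF assms(1,2,4)] by blast
qed

text \<open>Orthogonality of characters of a cyclic group: for nonzero \<open>s\<close> this is a
  geometric sum whose ratio \<open>q\<close> is an \<open>L\<close>-th root of unity other than
  1.\<close>

lemma sum_roots_unity_powers:
  assumes "s < L"
  shows "(\<Sum>m<L. (1 / cis (2 * pi * real m / real L)) ^ s) = (if s = 0 then of_nat L else 0)"
proof (cases "s = 0")
  case False
  have L: "0 < L" using assms by simp
  define q where "q = 1 / cis (2 * pi * real s / real L)"
  have bij: "bij_betw (\<lambda>k. cis (2 * pi * real k / real L)) {..<L} {z. z ^ L = 1}"
    using L by (rule bij_betw_roots_unity)
  have "cis (2 * pi * real s / real L) \<in> {z. z ^ L = 1}"
    using bij_betwE[OF bij] assms by simp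
  then have "q ^ L = 1" by (simp add: q_def power_one_over)
  have "cis (2 * pi * real s / real L) \<noteq> cis (2 * pi * real 0 / real L)"
    using bij_betw_imp_inj_on[OF bij] False assms L unfolding inj_on_def by (metis lessThan_iff)
  then have "q \<noteq> 1" by (simp add: q_def)
  have "(1 / cis (2 * pi * real m / real L)) ^ s = q ^ m" for m
    by (simp add: q_def power_one_over DeMoivre mult_ac)
  then show ?thesis using \<open>q \<noteq> 1\<close> \<open>q ^ L = 1\<close> False by (simp add: geometric_sum)
qed simp

section \<open>Functions scaled by a constant along arcs\<close>

definition (in pre_digraph) multiplicative :: "complex \<Rightarrow> ('a \<Rightarrow> complex) \<Rightarrow> bool" where
  "multiplicative \<theta> w \<longleftrightarrow> (\<forall>e\<in>arcs G. w (head G e) = \<theta> * w (tail G e))"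

lemma (in fin_digraph) multiplicative_eq_0:
  assumes "strongly_connected G" "multiplicative \<theta> w" "u \<in> verts G" "w u = 0" "v \<in> verts G"
  shows "w v = 0"
  using assms by (intro strongly_connected_induct[of u v "\<lambda>v. w v = 0"]) (auto simp: multiplicative_def)

lemma (in pre_digraph) multiplicative_diff:
  assumes "multiplicative \<theta> w" "multiplicative \<theta> w'"
  shows "multiplicative \<theta> (\<lambda>v. w v - c * w' v)"
  using assms by (simp add: multiplicative_def right_diff_distrib)

text \<open>Subtracting the multiple of \<open>w'\<close> that agrees with \<open>w\<close> at
  \<open>u\<close> leaves a multiplicative function with a zero, which vanishes on all
  vertices.\<close>

lemma (in fin_digraph) multiplicative_unique:
  assumes "strongly_connected G" "multiplicative \<theta> w" "multiplicative \<theta> w'"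
    and "u \<in> verts G" "w' u \<noteq> 0" "v \<in> verts G"
  shows "w v = w u / w' u * w' v"
  using multiplicative_eq_0[OF assms(1) multiplicative_diff[OF assms(2,3), of "w u / w' u"] assms(4) _ assms(6)]
    assms(5) by simp

text \<open>The positive eigenvector is a parameter, because the equality case supplies an explicit
  one built from the outdegree vector.\<close>

locale perron_digraph = enumerated_digraph +
  fixes p :: "'a \<Rightarrow> real"
  assumes strong: "strongly_connected G"
    and p_pos: "v \<in> verts G \<Longrightarrow> 0 < p v"
    and p_eigen: "v \<in> verts G \<Longrightarrow> out_sum p v = \<rho> * p v"
    and \<rho>_pos: "0 < \<rho>"
begin

lemma eigenfun_of_multiplicative:
  fixes \<theta> :: complex and w :: "'a \<Rightarrow> complex"
  assumes "multiplicative \<theta> w" "u \<in> verts G"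
  shows "out_sum (\<lambda>v. p v * w v) u = \<rho> * \<theta> * (p u * w u)"
proof -
  have "out_sum (\<lambda>v. p v * w v) u = (\<Sum>e\<in>out_arcs G u. of_real (p (head G e)) * (\<theta> * w u))"
    unfolding out_sum_def using assms by (intro sum.cong) (auto simp: multiplicative_def)
  also have "\<dots> = of_real (out_sum p u) * (\<theta> * w u)"
    by (simp add: out_sum_def sum_distrib_right)
  finally show ?thesis by (simp add: p_eigen[OF assms(2)])
qed

text \<open>
  A maximum principle: at a vertex where \<open>\<bar>f / p\<bar>\<close> is maximal, the value \<open>\<theta> f / p\<close> on the boundary of
  the disc is a convex combination of the values at the successors, which lie in the disc.
\<close>

lemma multiplicative_of_peripheral:
  fixes \<theta> :: complex and f :: "'a \<Rightarrow> complex"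
  assumes \<theta>: "cmod \<theta> = 1" and f: "\<And>u. u \<in> verts G \<Longrightarrow> out_sum f u = \<rho> * \<theta> * f u"
  shows "multiplicative \<theta> (\<lambda>v. f v / p v)"
proof -
  define w where "w v = f v / p v" for v
  have fw: "f v = p v * w v" if "v \<in> verts G" for v using p_pos[OF that] by (simp add: w_def)
  obtain M m where m: "m \<in> verts G" "cmod (f m) = M * p m"
    and "\<And>v. v \<in> verts G \<Longrightarrow> cmod (f v) \<le> M * p v"
    using p_pos by (rule tight_bound_by_positive[where f = f]) blast+
  then have w_le: "cmod (w v) \<le> M" if "v \<in> verts G" for v
    using that p_pos[OF that] by (auto simp: w_def norm_divide divide_le_eq)
  have step: "w (head G e) = \<theta> * w (tail G e)"
    if e: "e \<in> arcs G" and M: "cmod (w (tail G e)) = M" for e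
  proof -
    define u c where "u = tail G e" and "c = \<theta> * w u"
    have u: "u \<in> verts G" using e by (simp add: u_def)
    have c: "cmod c = M" using M \<theta> by (simp add: c_def u_def norm_mult)
    \<comment> \<open>\<open>g v\<close> measures how far \<open>w v\<close> falls short of
      \<open>c\<close> in the direction of \<open>c\<close>. It is nonnegative and its
      \<open>p\<close>-weighted sum over the successors of \<open>u\<close> is zero, so it vanishes
      at each of them.\<close>
    define g where "g v = M\<^sup>2 - Re (cnj c * w v)" for v
    have g: "0 \<le> g v" if "v \<in> verts G" for v
    proof -
      have "Re (cnj c * w v) \<le> cmod (cnj c * w v)" by (rule complex_Re_le_cmod)
      also have "\<dots> \<le> M * M"
        using w_le[OF that] c by (auto simp: norm_mult intro!: mult_left_mono)
      finally show ?thesis by (simp add: g_def power2_eq_square)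
    qed
    have "cnj c * out_sum f u = \<rho> * p u * (cnj c * c)"
      using f[OF u] fw[OF u] by (simp add: c_def mult_ac)
    also have "cnj c * c = of_real (M\<^sup>2)"
      using complex_norm_square[of c] c by (simp add: mult_ac)
    finally have "Re (cnj c * out_sum f u) = \<rho> * p u * M\<^sup>2" by simp
    moreover have "cnj c * out_sum f u
        = (\<Sum>e\<in>out_arcs G u. of_real (p (head G e)) * (cnj c * w (head G e)))"
      unfolding out_sum_def sum_distrib_left by (intro sum.cong) (auto simp: fw mult_ac)
    ultimately have "(\<Sum>e\<in>out_arcs G u. p (head G e) * Re (cnj c * w (head G e))) = out_sum p u * M\<^sup>2"
      by (simp add: p_eigen[OF u] Re_sum)
    then have "(\<Sum>e\<in>out_arcs G u. p (head G e) * g (head G e)) = 0"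
      by (simp add: g_def right_diff_distrib sum_subtractf out_sum_def sum_distrib_right)
    moreover have "0 \<le> p (head G e') * g (head G e')" if "e' \<in> out_arcs G u" for e'
      using that g[of "head G e'"] p_pos[of "head G e'"] by simp
    ultimately have "p (head G e) * g (head G e) = 0"
      using e sum_nonneg_eq_0_iff[of "out_arcs G u" "\<lambda>e. p (head G e) * g (head G e)"]
      by (simp add: u_def)
    then have g0: "g (head G e) = 0" using p_pos[of "head G e"] e by simp
    \<comment> \<open>Law of cosines: \<open>w (head G e)\<close> has modulus at most
      \<open>M\<close> and inner product \<open>M^2\<close> with \<open>c\<close>, which leaves no
      distance to \<open>c\<close>.\<close>
    have "(cmod (w (head G e) - c))\<^sup>2 = (cmod (w (head G e)))\<^sup>2 + (cmod c)\<^sup>2 - 2 * Re (cnj c * w (head G e))"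
      unfolding cmod_power2 by (simp add: power2_eq_square algebra_simps)
    also have "\<dots> \<le> 0"
      using g0 c power_mono[OF w_le[of "head G e"], of 2] e by (simp add: g_def)
    finally show ?thesis by (simp add: c_def u_def)
  qed
  have "cmod (w v) = M" if "v \<in> verts G" for v
  proof (rule strongly_connected_induct[OF strong m(1) that])
    show "cmod (w m) = M" using m p_pos[OF m(1)] by (simp add: w_def norm_divide)
    show "cmod (w (head G e)) = M" if "e \<in> arcs G" "cmod (w (tail G e)) = M" for e
      using step[OF that] that \<theta> by (simp add: norm_mult)
  qed
  then show ?thesis using step by (auto simp: multiplicative_def w_def)
qed

text \<open>A multiple root yields independent \<open>f\<close> and \<open>g\<close>. If
  \<open>b\<close> is nonzero, \<open>A^k g\<close> grows like \<open>k \<rho>^k\<close>, against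
  its bound by a multiple of \<open>\<rho>^k p\<close>; if \<open>b\<close> is 0, both quotients by
  \<open>p\<close> are scaled by the same phase and hence proportional.\<close>

lemma peripheral_order_eq_1:
  assumes "eigenvalue A z" "cmod z = \<rho>"
  shows "Polynomial.order z (char_poly A) = 1"
proof (rule antisym)
  have "char_poly A \<noteq> 0" using degree_monic_char_poly[OF A_carrier] by auto
  then show "1 \<le> Polynomial.order z (char_poly A)"
    using assms(1) by (simp add: eigenvalue_root_char_poly[OF A_carrier] order_root Suc_le_eq)
  show "Polynomial.order z (char_poly A) \<le> 1"
  proof (rule ccontr)
    assume "\<not> Polynomial.order z (char_poly A) \<le> 1"
    then have "2 \<le> Polynomial.order z (char_poly A)" by simp
    then obtain f g b where f: "\<And>u. u \<in> verts G \<Longrightarrow> out_sum f u = z * f u"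
      and g: "\<And>u. u \<in> verts G \<Longrightarrow> out_sum g u = z * g u + b * f u"
      and indep: "\<And>c d. (\<And>v. v \<in> verts G \<Longrightarrow> c * f v + d * g v = 0) \<Longrightarrow> c = 0 \<and> d = 0"
      by (rule double_root_generalized_eigenfuns) blast
    obtain u where u: "u \<in> verts G" "f u \<noteq> 0" using indep[of 1 0] by auto
    \<comment> \<open>The extra factor \<open>z\<close> on the left avoids the exponent
      \<open>k - 1\<close>, so the formula also holds for \<open>k = 0\<close>.\<close>
    have pow: "z * (out_sum ^^ k) g v = z ^ Suc k * g v + of_nat k * z ^ k * b * f v"
      if "v \<in> verts G" for k v
      using that
    proof (induction k arbitrary: v)
      case (Suc k)
      have "z * (out_sum ^^ Suc k) g v = out_sum (\<lambda>v. z * (out_sum ^^ k) g v) v"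
        by (simp add: out_sum_scale)
      also have "\<dots> = out_sum (\<lambda>v. z ^ Suc k * g v + of_nat k * z ^ k * b * f v) v"
        by (subst out_sum_cong[OF Suc.IH]) simp_all
      also have "\<dots> = z ^ Suc k * out_sum g v + of_nat k * z ^ k * b * out_sum f v"
        by (simp add: out_sum_def sum.distrib sum_distrib_left)
      finally show ?case by (simp add: f[OF Suc.prems] g[OF Suc.prems] algebra_simps)
    qed simp
    obtain t where t: "\<And>v. v \<in> verts G \<Longrightarrow> cmod (g v) \<le> t * p v"
      using p_pos by (rule tight_bound_by_positive[where f = g]) blast+
    have "real k * (cmod b * cmod (f u)) \<le> \<rho> * t * p u + \<rho> * cmod (g u)" for k
    proof -
      have p: "(out_sum ^^ k) p u = \<rho> ^ k * p u"
        using out_sum_pow_eigen[of 1 p \<rho> u k] p_eigen u by simp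
      have gk: "cmod ((out_sum ^^ k) g u) \<le> t * (out_sum ^^ k) p u"
        using t u(1) by (rule norm_eigenfun_pow_le)
      have "of_nat k * z ^ k * b * f u = z * (out_sum ^^ k) g u - z ^ Suc k * g u"
        using pow[OF u(1), of k] by simp
      then have "cmod (of_nat k * z ^ k * b * f u) \<le> cmod (z * (out_sum ^^ k) g u) + cmod (z ^ Suc k * g u)"
        by (metis norm_triangle_ineq4)
      also have "\<dots> \<le> \<rho> * (t * (\<rho> ^ k * p u)) + \<rho> ^ Suc k * cmod (g u)"
        using gk assms \<rho>_pos
        by (simp add: norm_mult norm_power p)
      finally have "\<rho> ^ k * (real k * (cmod b * cmod (f u))) \<le> \<rho> ^ k * (\<rho> * t * p u + \<rho> * cmod (g u))"
        using assms by (simp add: norm_mult norm_power algebra_simps)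
      then show ?thesis using \<rho>_pos by simp
    qed
    then have "\<not> 0 < cmod b * cmod (f u)"
      using reals_Archimedean3 linorder_not_less by metis
    then have "b = 0" using u by (simp add: zero_less_mult_iff)
    define \<theta> where "\<theta> = z / \<rho>"
    have \<theta>: "cmod \<theta> = 1" "of_real \<rho> * \<theta> = z" using assms \<rho>_pos by (simp_all add: \<theta>_def norm_divide)
    have mf: "multiplicative \<theta> (\<lambda>v. f v / p v)" and mg: "multiplicative \<theta> (\<lambda>v. g v / p v)"
      using f g \<open>b = 0\<close> \<theta> by (auto intro!: multiplicative_of_peripheral)
    have "f u / p u \<noteq> 0" using u p_pos[OF u(1)] by simp
    then have gv: "g v / p v = (g u / p u) / (f u / p u) * (f v / p v)" if "v \<in> verts G" for v
      using that by (rule multiplicative_unique[OF strong mg mf u(1)])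
    then have "g u * f v + (- f u) * g v = 0" if "v \<in> verts G" for v
      using gv[OF that] u(2) p_pos[OF u(1)] p_pos[OF that] by (simp add: field_simps)
    then have "g u = 0 \<and> - f u = 0" by (rule indep)
    then show False using u by simp
  qed
qed

section \<open>The group of phases\<close>

definition phases :: "complex set" where
  "phases = {\<theta>. cmod \<theta> = 1 \<and> (\<exists>w. multiplicative \<theta> w \<and> (\<exists>v\<in>verts G. w v \<noteq> 0))}"

lemma multiplicative_nonzero:
  assumes "multiplicative \<theta> w" "\<exists>v\<in>verts G. w v \<noteq> 0" "v \<in> verts G"
  shows "w v \<noteq> 0"
  using assms multiplicative_eq_0[OF strong] by blast

text \<open>Dividing by \<open>p\<close> turns eigenfunctions of maximal modulus into functions
  scaled along arcs, and multiplying by \<open>p\<close> leads back.\<close>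

lemma peripheral_spectrum: "{z. eigenvalue A z \<and> cmod z = \<rho>} = (*) (of_real \<rho>) ` phases"
proof (intro equalityI subsetI)
  fix z assume "z \<in> {z. eigenvalue A z \<and> cmod z = \<rho>}"
  then obtain f where f: "eigenfun z f" and z: "cmod z = \<rho>" by (auto simp: eigenvalue_iff_eigenfun)
  define \<theta> where "\<theta> = z / \<rho>"
  have \<theta>: "cmod \<theta> = 1" "z = of_real \<rho> * \<theta>" using z \<rho>_pos by (simp_all add: \<theta>_def norm_divide)
  have "multiplicative \<theta> (\<lambda>v. f v / p v)"
    using f \<theta> by (intro multiplicative_of_peripheral) (auto simp: eigenfun_def)
  moreover obtain v where "v \<in> verts G" "f v \<noteq> 0" using f by (auto simp: eigenfun_def)
  then have "\<exists>v\<in>verts G. f v / p v \<noteq> 0" using p_pos[of v] by (intro bexI[of _ v]) auto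
  ultimately have "\<theta> \<in> phases" unfolding phases_def using \<theta> by blast
  then show "z \<in> (*) (of_real \<rho>) ` phases" using \<theta>(2) by blast
next
  fix z assume "z \<in> (*) (of_real \<rho>) ` phases"
  then obtain \<theta> w v where z: "z = of_real \<rho> * \<theta>" "cmod \<theta> = 1" and w: "multiplicative \<theta> w"
    and v: "v \<in> verts G" "w v \<noteq> 0" by (auto simp: phases_def)
  have "eigenfun z (\<lambda>v. p v * w v)"
    unfolding eigenfun_def
  proof
    show "\<exists>v\<in>verts G. p v * w v \<noteq> 0" using v p_pos[OF v(1)] by (intro bexI[of _ v]) auto
  qed (simp add: eigenfun_of_multiplicative[OF w] z(1))
  then show "z \<in> {z. eigenvalue A z \<and> cmod z = \<rho>}"
    using z \<rho>_pos by (auto simp: eigenvalue_iff_eigenfun norm_mult)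
qed

lemma inj_scale: "inj_on ((*) (complex_of_real \<rho>)) S"
  using \<rho>_pos by (auto intro!: inj_onI)

lemma finite_phases: "finite phases"
proof -
  have "finite ((*) (complex_of_real \<rho>) ` phases)"
    unfolding peripheral_spectrum[symmetric]
    by (rule finite_subset[OF _ card_finite_spectrum(1)[OF A_carrier]]) (auto simp: spectrum_def)
  then show ?thesis by (rule finite_imageD) (rule inj_scale)
qed

lemma imprimitivity_index_eq_card: "imprimitivity_index G vs = card phases"
proof -
  have "imprimitivity_index G vs = card {z. eigenvalue A z \<and> cmod z = \<rho>}"
    unfolding imprimitivity_index_def by (simp add: peripheral_order_eq_1)
  then show ?thesis by (simp add: peripheral_spectrum card_image inj_scale)
qed

text \<open>Pointwise products of functions scaled by \<theta> and \<theta>' are scaled by their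
  product and vanish nowhere, so the finite set \<open>phases\<close> is closed under
  multiplication.\<close>

lemma phases_eq_roots_unity: "phases = {z. z ^ imprimitivity_index G vs = 1}"
  unfolding imprimitivity_index_eq_card
proof (rule finite_mult_closed_eq_roots_unity[OF finite_phases])
  show "0 \<notin> phases" by (auto simp: phases_def)
  have "1 \<in> phases"
    using verts_nonempty by (auto simp: phases_def multiplicative_def intro!: exI[of _ "\<lambda>_. 1"])
  then show "phases \<noteq> {}" by blast
  fix \<theta> \<theta>' assume "\<theta> \<in> phases" "\<theta>' \<in> phases"
  then obtain w w' where w: "multiplicative \<theta> w" "\<exists>v\<in>verts G. w v \<noteq> 0"
    and w': "multiplicative \<theta>' w'" "\<exists>v\<in>verts G. w' v \<noteq> 0" and 1: "cmod \<theta> = 1" "cmod \<theta>' = 1"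
    unfolding phases_def by blast
  have "multiplicative (\<theta> * \<theta>') (\<lambda>v. w v * w' v)"
    using w w' by (auto simp: multiplicative_def)
  moreover have "\<exists>v\<in>verts G. w v * w' v \<noteq> 0"
    using multiplicative_nonzero[OF w] multiplicative_nonzero[OF w'] verts_nonempty by auto
  moreover have "cmod (\<theta> * \<theta>') = 1" using 1 by (simp add: norm_mult)
  ultimately show "\<theta> * \<theta>' \<in> phases" unfolding phases_def by blast
qed

end

section \<open>Level sets of peripheral eigenfunctions\<close>

text \<open>Bezout in the natural numbers, with the subtraction moved to the other side.\<close>

lemma power_gcd_eq_1:
  fixes z :: "'c::field"
  assumes "z ^ a = 1" "z ^ b = 1"
  shows "z ^ gcd a b = 1"
proof (cases "a = 0")
  case False
  then obtain x y where "a * x = b * y + gcd a b" using bezout_nat by blast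
  then have "(z ^ a) ^ x = (z ^ b) ^ y * z ^ gcd a b"
    by (metis power_add power_mult)
  then show ?thesis using assms by simp
qed (use assms in simp)

lemma cis_power_root_unity: "cis (2 * pi / real r) ^ j = cis (2 * pi * real j / real r)"
  by (simp add: DeMoivre mult_ac)

lemma root_unity_eq_power:
  assumes "z ^ r = 1" "0 < r"
  obtains j where "j < r" "z = cis (2 * pi / real r) ^ j"
proof -
  have "z \<in> (\<lambda>k. cis (2 * pi * real k / real r)) ` {..<r}"
    using bij_betw_imp_surj_on[OF bij_betw_roots_unity[OF \<open>0 < r\<close>]] assms by simp
  then show thesis using that by (auto simp: cis_power_root_unity)
qed

lemma cis_root_unity: "0 < r \<Longrightarrow> cis (2 * pi / real r) ^ r = 1"
  by (simp add: DeMoivre)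

lemma cis_root_unity_inj:
  assumes "cis (2 * pi / real r) ^ i = cis (2 * pi / real r) ^ j" "i \<in> {1..r}" "j \<in> {1..r}"
  shows "i = j"
proof -
  have r: "0 < r" using assms by simp
  have "cis (2 * pi / real r) ^ (i - 1) = cis (2 * pi / real r) ^ (j - 1)"
    using assms by (simp add: power_eq_if)
  moreover have "inj_on (\<lambda>k. cis (2 * pi * real k / real r)) {..<r}"
    using bij_betw_roots_unity[OF r] by (rule bij_betw_imp_inj_on)
  ultimately have "i - 1 = j - 1"
    using assms(2,3) unfolding cis_power_root_unity by (elim inj_onD) auto
  then show ?thesis using assms by auto
qed

context perron_digraph
begin

abbreviation "h \<equiv> imprimitivity_index G vs"

text \<open>
  Fourier decomposition: \<open>L x\<close> is the sum over the \<open>L\<close>-th roots of unity \<open>\<theta>\<close> of the vectors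
  \<open>\<Sum>s<L. (\<rho> \<theta>)\<^sup>-\<^sup>s A\<^sup>s x\<close>, each of which is \<open>0\<close> or an eigenvector for \<open>\<rho> \<theta>\<close>.
\<close>

lemma quotient_constant_on_levels:
  fixes x :: "'a \<Rightarrow> real"
  assumes x: "\<And>v. v \<in> verts G \<Longrightarrow> (out_sum ^^ L) x v = \<rho> ^ L * x v" and "0 < L"
    and w: "multiplicative (cis (2 * pi / real (gcd L h))) w"
    and u: "u \<in> verts G" and v: "v \<in> verts G" and uv: "w u = w v" "w u \<noteq> 0"
  shows "x u / p u = x v / p v"
proof -
  define r where "r = gcd L h"
  have r: "0 < r" using \<open>0 < L\<close> by (simp add: r_def)
  define X where "X v = complex_of_real (x v)" for v
  define \<theta> where "\<theta> m = cis (2 * pi * real m / real L)" for m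
  define c where "c m = of_real \<rho> * \<theta> m" for m
  define F where "F m a = (\<Sum>s<L. (1 / c m) ^ s * (out_sum ^^ s) X a)" for m a
  have \<theta>_L: "\<theta> m ^ L = 1" for m
  proof -
    have "\<theta> m ^ L = cis (2 * pi * real m)" using \<open>0 < L\<close> by (simp add: \<theta>_def DeMoivre)
    then show ?thesis by simp
  qed
  have c0: "c m \<noteq> 0" for m using \<rho>_pos by (simp add: c_def \<theta>_def)
  have X: "(out_sum ^^ L) X a = c m ^ L * X a" if "a \<in> verts G" for a m
    using x[OF that] unfolding X_def by (simp add: out_sum_pow_of_real c_def power_mult_distrib \<theta>_L)
  have "out_sum (F m) a = of_real \<rho> * \<theta> m * F m a" if "a \<in> verts G" for a m
    unfolding F_def using out_sum_pow_resolvent[OF c0 X that] by (simp add: c_def)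
  then have F: "multiplicative (\<theta> m) (\<lambda>a. F m a / p a)" for m
    by (intro multiplicative_of_peripheral) (simp add: \<theta>_def)
  have eq: "F m u / p u = F m v / p v" for m
  proof (cases "F m u / p u = 0")
    case True
    then show ?thesis using multiplicative_eq_0[OF strong F u True v] True by (simp only:)
  next
    case False
    moreover have "cmod (\<theta> m) = 1" by (simp add: \<theta>_def)
    \<comment> \<open>A nonvanishing component makes \<open>\<theta> m\<close> an
      \<open>h\<close>-th root of unity besides an \<open>L\<close>-th one. It is then a power of
      the primitive \<open>r\<close>-th root, and the component divided by \<open>p\<close> is a
      multiple of \<open>w ^ j\<close>.\<close>
    ultimately have "\<theta> m \<in> phases" unfolding phases_def using F[of m] u by blast
    then have "\<theta> m ^ r = 1"
      unfolding r_def using \<theta>_L by (intro power_gcd_eq_1) (auto simp: phases_eq_roots_unity)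
    then obtain j where "\<theta> m = cis (2 * pi / real r) ^ j" using r by (rule root_unity_eq_power)
    then have "multiplicative (\<theta> m) (\<lambda>a. w a ^ j)"
      using w by (auto simp: multiplicative_def r_def power_mult_distrib)
    then have "F m v / p v = F m u / p u / w u ^ j * w v ^ j"
      using uv by (intro multiplicative_unique[OF strong F _ u _ v]) auto
    then show ?thesis using uv by simp
  qed
  \<comment> \<open>After exchanging the sums, orthogonality removes every term except
    \<open>s = 0\<close>, which is \<open>X\<close> itself.\<close>
  have sum: "(\<Sum>m<L. F m a) = of_nat L * X a" for a
  proof -
    have c_power: "(1 / c m) ^ s = (1 / \<theta> m) ^ s * (1 / complex_of_real \<rho>) ^ s" for m s
      by (simp add: c_def power_divide power_mult_distrib)
    have "(\<Sum>m<L. F m a) = (\<Sum>s<L. (\<Sum>m<L. (1 / \<theta> m) ^ s) * ((1 / complex_of_real \<rho>) ^ s * (out_sum ^^ s) X a))"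
      unfolding F_def by (subst sum.swap) (simp only: c_power sum_distrib_right mult.assoc)
    also have "\<dots> = (\<Sum>s<L. if s = 0 then of_nat L * X a else 0)"
      by (intro sum.cong refl) (simp add: \<theta>_def sum_roots_unity_powers)
    finally show ?thesis using \<open>0 < L\<close> by simp
  qed
  have "of_nat L * (X u / p u) = (\<Sum>m<L. F m u / p u)"
    by (simp add: sum flip: sum_divide_distrib)
  also have "\<dots> = (\<Sum>m<L. F m v / p v)" by (simp only: eq)
  also have "\<dots> = of_nat L * (X v / p v)"
    by (simp add: sum flip: sum_divide_distrib)
  finally have "X u / p u = X v / p v"
    using \<open>0 < L\<close> by (subst (asm) mult_left_cancel) simp_all
  then have "complex_of_real (x u / p u) = complex_of_real (x v / p v)" by (simp add: X_def)
  then show ?thesis by (simp only: of_real_eq_iff)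
qed

text \<open>As \<open>r\<close> divides \<open>h\<close>, the primitive root \<omega> is a phase.
  Its function, normalised to 1 at a base vertex, takes only powers of \<omega> as values, and its
  level sets are the classes.\<close>

lemma cyclic_partition_levels:
  assumes no_sink: "\<forall>u\<in>verts G. \<not> is_sink G u" and "0 < r" "r dvd h"
  defines "\<omega> \<equiv> cis (2 * pi / real r)"
  obtains w where "multiplicative \<omega> w" "\<And>u. u \<in> verts G \<Longrightarrow> w u \<noteq> 0"
    "cyclic_partition G r (\<lambda>j. {u \<in> verts G. w u = \<omega> ^ j})"
proof -
  have \<omega>: "\<omega> ^ r = 1" unfolding \<omega>_def using \<open>0 < r\<close> by (rule cis_root_unity)
  have "\<omega> ^ h = 1" using \<open>r dvd h\<close> \<omega> by (metis dvdE power_mult power_one)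
  then have "\<omega> \<in> phases" by (simp add: phases_eq_roots_unity)
  then obtain w' where w': "multiplicative \<omega> w'" "\<exists>v\<in>verts G. w' v \<noteq> 0" by (auto simp: phases_def)
  obtain u0 where u0: "u0 \<in> verts G" using verts_nonempty by blast
  note nz = multiplicative_nonzero[OF w']
  define w where "w v = w' v / w' u0" for v
  have w: "multiplicative \<omega> w" using w' by (simp add: multiplicative_def w_def)
  have w_arc: "w (head G e) = \<omega> * w (tail G e)" if "e \<in> arcs G" for e
    using w that by (simp add: multiplicative_def)
  let ?V = "\<lambda>j. {u \<in> verts G. w u = \<omega> ^ j}"
  have w_r: "w v ^ r = 1" if "v \<in> verts G" for v
    using strong u0 that
  proof (rule strongly_connected_induct)
    show "w u0 ^ r = 1" using nz[OF u0] by (simp add: w_def)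
    show "w (head G e) ^ r = 1" if "e \<in> arcs G" "w (tail G e) ^ r = 1" for e
      using that \<omega> by (simp add: w_arc power_mult_distrib)
  qed
  have next_level: "\<omega> * \<omega> ^ j = \<omega> ^ (j mod r + 1)" for j
  proof -
    have "\<omega> ^ j = \<omega> ^ (r * (j div r) + j mod r)" by simp
    also have "\<dots> = \<omega> ^ (j mod r)" by (simp only: power_add power_mult \<omega>) simp
    finally show ?thesis by simp
  qed
  have step: "head G e \<in> ?V (j mod r + 1)" if "e \<in> arcs G" "tail G e \<in> ?V j" for e j
  proof -
    have "w (head G e) = \<omega> ^ (j mod r + 1)"
      using w_arc[OF that(1)] that(2) by (simp only: mem_Collect_eq next_level)
    with that(1) show ?thesis by simp
  qed
  have nonempty: "?V (j mod r + 1) \<noteq> {}" if ne: "?V j \<noteq> {}" for j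
  proof -
    obtain u where u: "u \<in> ?V j" using ne by blast
    then obtain e where "e \<in> out_arcs G u"
      using no_sink by (fastforce simp: is_sink_def out_degree_def)
    then have "head G e \<in> ?V (j mod r + 1)" using step[of e j] u by simp
    then show ?thesis by blast
  qed
  have "cyclic_partition G r ?V"
    unfolding cyclic_partition_def
  proof (intro conjI ballI impI)
    show "(\<Union>j\<in>{1..r}. ?V j) = verts G"
    proof (intro equalityI subsetI)
      fix u assume u: "u \<in> verts G"
      from w_r[OF u] \<open>0 < r\<close> obtain j where j: "j < r" "w u = \<omega> ^ j"
        unfolding \<omega>_def by (rule root_unity_eq_power)
      \<comment> \<open>Classes are numbered from 1, so the exponent 0 is replaced by
        \<open>r\<close>.\<close>
      then have "w u = \<omega> ^ (if j = 0 then r else j)" using \<omega> by simp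
      moreover have "(if j = 0 then r else j) \<in> {1..r}" using j \<open>0 < r\<close> by auto
      ultimately show "u \<in> (\<Union>j\<in>{1..r}. ?V j)" using u by blast
    qed auto
    show "disjoint_family_on ?V {1..r}"
      using cis_root_unity_inj[of r, folded \<omega>_def] by (force simp: disjoint_family_on_def)
    show "?V j \<noteq> {}" if j: "j \<in> {1..r}" for j
    proof -
      \<comment> \<open>The base vertex lies in class \<open>r\<close>. Since no vertex is a sink,
        nonemptiness passes from each class to the next, first from \<open>r\<close> to 1.\<close>
      have "?V (Suc i) \<noteq> {}" if "i < r" for i
        using that
      proof (induction i)
        case 0
        have "u0 \<in> ?V r" using u0 nz[OF u0] \<omega> by (simp add: w_def)
        then have "?V (r mod r + 1) \<noteq> {}" by (intro nonempty) blast
        then show ?case by simp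
      next
        case (Suc i)
        then have "?V (Suc i mod r + 1) \<noteq> {}" by (intro nonempty) simp
        then show ?case using Suc.prems by simp
      qed
      moreover obtain i where "j = Suc i" "i < r" using j by (cases j) auto
      ultimately show ?thesis by blast
    qed
  qed (use step in auto)
  moreover have "w u \<noteq> 0" if "u \<in> verts G" for u
    using nz[OF that] nz[OF u0] by (simp add: w_def)
  ultimately show thesis using w that by blast
qed

text \<open>Arcs leaving one level all end in the next, where \<open>x = \<kappa> p\<close> for one
  constant. So \<open>out_sum x\<close> is \<open>\<kappa> \<rho> p\<close> on the level, and
  \<open>p / x\<close> is constant there too.\<close>

lemma quasiregular_of_power_eigen:
  fixes x :: "'a \<Rightarrow> real"
  assumes no_sink: "\<forall>u\<in>verts G. \<not> is_sink G u"
    and x: "\<And>v. v \<in> verts G \<Longrightarrow> (out_sum ^^ L) x v = \<rho> ^ L * x v" and "0 < L"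
    and pos: "\<And>v. v \<in> verts G \<Longrightarrow> 0 < x v"
  obtains V c where "cyclic_partition G (gcd L h) V"
    "\<And>j u. j \<in> {1..gcd L h} \<Longrightarrow> u \<in> V j \<Longrightarrow> out_sum x u / x u = c j"
proof -
  define r where "r = gcd L h"
  have r: "0 < r" "r dvd h" using \<open>0 < L\<close> by (simp_all add: r_def)
  define \<omega> where "\<omega> = cis (2 * pi / real r)"
  obtain w where w: "multiplicative \<omega> w" "\<And>u. u \<in> verts G \<Longrightarrow> w u \<noteq> 0"
    and V: "cyclic_partition G r (\<lambda>j. {u \<in> verts G. w u = \<omega> ^ j})"
    unfolding \<omega>_def using no_sink r by (rule cyclic_partition_levels) blast
  have level: "x u / p u = x v / p v" if "u \<in> verts G" "v \<in> verts G" "w u = w v" for u v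
    using quotient_constant_on_levels[OF x \<open>0 < L\<close> w(1)[unfolded \<omega>_def r_def] that(1,2,3) w(2)[OF that(1)]] .
  have ratio: "out_sum x u / x u = out_sum x v / x v"
    if uv: "u \<in> verts G" "v \<in> verts G" "w u = w v" for u v
  proof -
    obtain e where e: "e \<in> out_arcs G u"
      using no_sink uv(1) by (fastforce simp: is_sink_def out_degree_def)
    define \<kappa> where "\<kappa> = x (head G e) / p (head G e)"
    have out: "out_sum x a = \<kappa> * (\<rho> * p a)" if a: "a \<in> verts G" "w a = w u" for a
    proof -
      have "x (head G e') = \<kappa> * p (head G e')" if "e' \<in> out_arcs G a" for e'
      proof -
        have "w (head G e') = w (head G e)"
          using w(1) that e a(2) by (auto simp: multiplicative_def)
        then have "x (head G e') / p (head G e') = \<kappa>"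
          unfolding \<kappa>_def using that e by (intro level) auto
        then show ?thesis using p_pos[of "head G e'"] that by (simp add: field_simps)
      qed
      then have "out_sum x a = (\<Sum>e'\<in>out_arcs G a. \<kappa> * p (head G e'))"
        unfolding out_sum_def by (rule sum.cong[OF refl])
      also have "\<dots> = \<kappa> * out_sum p a" by (simp add: out_sum_def sum_distrib_left)
      finally show ?thesis by (simp add: p_eigen[OF a(1)])
    qed
    have "p u / x u = p v / x v"
      using level[OF uv] pos[OF uv(1)] pos[OF uv(2)] p_pos[OF uv(1)] p_pos[OF uv(2)]
      by (simp add: field_simps)
    moreover have "out_sum x u / x u = \<kappa> * \<rho> * (p u / x u)" using out[OF uv(1)] by simp
    moreover have "out_sum x v / x v = \<kappa> * \<rho> * (p v / x v)" using out[OF uv(2)] uv(3) by simp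
    ultimately show ?thesis by (simp only:)
  qed
  \<comment> \<open>Any vertex of class \<open>j\<close> may represent it, since
    \<open>ratio\<close> makes the quotient independent of the choice.\<close>
  let ?c = "\<lambda>j. out_sum x (SOME v. v \<in> verts G \<and> w v = \<omega> ^ j) / x (SOME v. v \<in> verts G \<and> w v = \<omega> ^ j)"
  have "out_sum x u / x u = ?c j" if "u \<in> {u \<in> verts G. w u = \<omega> ^ j}" for u j
  proof -
    have "\<exists>v. v \<in> verts G \<and> w v = \<omega> ^ j" using that by blast
    from someI_ex[OF this] show ?thesis using that by (intro ratio) auto
  qed
  then show thesis by (rule that[OF V[unfolded r_def]])
qed

end

section \<open>The bounds and their equality cases\<close>

context enumerated_digraph
begin

text \<open>The hypothesis provides a Perron vector, so the cyclic partition by levels is available.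
  For \<open>r = 1\<close> its only class is the whole vertex set, which is the regular
  case.\<close>

lemma regular_or_quasiregular_of_power_eigen:
  fixes k L :: nat
  defines "x \<equiv> (out_sum ^^ k) (\<lambda>_. 1 :: real)"
  assumes strong: "strongly_connected G" and no_sink: "\<forall>u\<in>verts G. \<not> is_sink G u"
    and "0 < L" and \<rho>: "0 < \<rho>" and x: "\<And>v. v \<in> verts G \<Longrightarrow> (out_sum ^^ L) x v = \<rho> ^ L * x v"
  shows "avg_outdegree_regular G (k + 1)
    \<or> avg_outdegree_quasiregular G vs (k + 1) (gcd L (imprimitivity_index G vs))"
proof -
  have x_pos: "0 < (out_sum ^^ s) x v" if "v \<in> verts G" for s v
    using that unfolding x_def by (intro out_sum_pow_pos no_sink) simp_all
  have pos: "0 < x v" if "v \<in> verts G" for v using x_pos[OF that, of 0] by simp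
  \<comment> \<open>All summands are positive, and \<open>out_sum_pow_resolvent\<close> makes the
    sum an eigenvector for \<rho>.\<close>
  define p where "p v = (\<Sum>s<L. (1 / \<rho>) ^ s * (out_sum ^^ s) x v)" for v
  interpret P: perron_digraph G vs p
  proof unfold_locales
    fix v assume v: "v \<in> verts G"
    show "0 < p v"
      unfolding p_def using \<rho> x_pos[OF v] \<open>0 < L\<close> by (intro sum_pos) auto
    show "out_sum p v = \<rho> * p v"
      unfolding p_def using \<rho> x v by (intro out_sum_pow_resolvent) auto
  qed (fact strong \<rho>)+
  define r where "r = gcd L (imprimitivity_index G vs)"
  have ratio: "real (k_outdegree G (k + 1) u) / real (k_outdegree G (k + 1 - 1) u) = out_sum x u / x u"
    if "u \<in> verts G" for u
    using that by (simp add: real_k_outdegree x_def)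
  obtain V c where V: "cyclic_partition G r V"
    and c: "\<And>j u. j \<in> {1..r} \<Longrightarrow> u \<in> V j \<Longrightarrow> out_sum x u / x u = c j"
    unfolding r_def using P.quasiregular_of_power_eigen[OF no_sink x \<open>0 < L\<close> pos] by blast
  have V_verts: "(\<Union>j\<in>{1..r}. V j) = verts G" using V by (simp add: cyclic_partition_def)
  have "0 < r" using \<open>0 < L\<close> by (simp add: r_def)
  then consider "r = 1" | "1 < r" by linarith
  then show ?thesis
  proof cases
    case 1
    then have "V 1 = verts G" using V_verts by simp
    then have "\<forall>u\<in>verts G. out_sum x u / x u = c 1" using c[of 1] 1 by simp
    then have "avg_outdegree_regular G (k + 1)"
      unfolding avg_outdegree_regular_def using ratio by (intro conjI exI[of _ "c 1"]) simp_all
    then show ?thesis ..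
  next
    case 2
    then have "cyclically_partite G vs r"
      using strong by (simp add: cyclically_partite_def r_def)
    moreover have "\<forall>j\<in>{1..r}. \<forall>u\<in>V j.
        real (k_outdegree G (k + 1) u) / real (k_outdegree G (k + 1 - 1) u) = c j"
    proof (intro ballI)
      fix j u assume j: "j \<in> {1..r}" and u: "u \<in> V j"
      then have "u \<in> verts G" using V_verts by blast
      then show "real (k_outdegree G (k + 1) u) / real (k_outdegree G (k + 1 - 1) u) = c j"
        using ratio c[OF j u] by (simp only:)
    qed
    ultimately have "avg_outdegree_quasiregular G vs (k + 1) r"
      unfolding avg_outdegree_quasiregular_def using V by (intro conjI) (simp, blast+)
    then show ?thesis by (simp add: r_def)
  qed
qed

text \<open>Regularity makes \<open>x\<close> an eigenvector of \<open>A\<close> itself;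
  quasiregularity does so up to a factor depending on the class, and these factors multiply to one
  constant over \<open>L\<close> steps.\<close>

lemma power_eigen_of_regular_or_quasiregular:
  fixes k L :: nat
  defines "x \<equiv> (out_sum ^^ k) (\<lambda>_. 1 :: real)"
  assumes no_sink: "\<forall>u\<in>verts G. \<not> is_sink G u"
    and reg: "avg_outdegree_regular G (k + 1)
      \<or> avg_outdegree_quasiregular G vs (k + 1) (gcd L (imprimitivity_index G vs))"
  obtains C where "\<And>v. v \<in> verts G \<Longrightarrow> (out_sum ^^ L) x v = C * x v"
proof -
  have pos: "0 < x v" if "v \<in> verts G" for v
    using that unfolding x_def by (intro out_sum_pow_pos no_sink) simp_all
  have "0 < out_sum x v" if "v \<in> verts G" for v
    using out_sum_pow_pos[of x v 1] no_sink pos that by simp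
  then have ratio_pos: "0 < out_sum x v / x v" if "v \<in> verts G" for v
    using pos that by simp
  have ratio: "real (k_outdegree G (k + 1) u) / real (k_outdegree G (k + 1 - 1) u) = out_sum x u / x u"
    if "u \<in> verts G" for u
    using that by (simp add: real_k_outdegree x_def)
  from reg show thesis
  proof
    assume "avg_outdegree_regular G (k + 1)"
    then obtain c where c: "\<forall>u\<in>verts G. out_sum x u / x u = c"
      unfolding avg_outdegree_regular_def using ratio by auto
    have "out_sum x v = c * x v" if "v \<in> verts G" for v
      using c that pos[OF that] by (auto simp: field_simps)
    then have "(out_sum ^^ (1 * L)) x v = c ^ L * x v" if "v \<in> verts G" for v
      using that by (intro out_sum_pow_eigen) simp_all
    then show thesis by (intro that[of "c ^ L"]) simp
  next
    define r where "r = gcd L (imprimitivity_index G vs)"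
    assume "avg_outdegree_quasiregular G vs (k + 1) (gcd L (imprimitivity_index G vs))"
    then obtain V c where r: "1 < r" and V: "cyclic_partition G r V"
      and c: "\<forall>j\<in>{1..r}. \<forall>u\<in>V j.
        real (k_outdegree G (k + 1) u) / real (k_outdegree G (k + 1 - 1) u) = c j"
      unfolding avg_outdegree_quasiregular_def cyclically_partite_def r_def by blast
    have V_verts: "u \<in> verts G" if "j \<in> {1..r}" "u \<in> V j" for j u
      using V that unfolding cyclic_partition_def by blast
    have c': "out_sum x u / x u = c j" if "j \<in> {1..r}" "u \<in> V j" for j u
      using c ratio[OF V_verts[OF that]] that by simp
    have c_pos: "0 < c j" if j: "j \<in> {1..r}" for j
    proof -
      obtain u where u: "u \<in> V j" using V j unfolding cyclic_partition_def by blast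
      show ?thesis using ratio_pos[OF V_verts[OF j u]] c'[OF j u] by simp
    qed
    have xc: "out_sum x u = c j * x u" if "j \<in> {1..r}" "u \<in> V j" for j u
      using c'[OF that] pos[OF V_verts[OF that]] by (auto simp: field_simps)
    have "1 \<le> r" "r dvd L" using r by (simp_all add: r_def)
    with V show thesis using xc c_pos by (rule cyclic_out_sum_pow_period[where c = c and x = x]) (assumption+, rule that)
  qed
qed

lemma spectral_radius_walk_bounds:
  fixes k L :: nat
  assumes no_sink: "\<forall>u\<in>verts G. \<not> is_sink G u" and L: "0 < L"
  defines "ratios \<equiv> (\<lambda>u. root L (real (k_outdegree G (k + L) u) / real (k_outdegree G k u))) ` verts G"
    and "R \<equiv> avg_outdegree_regular G (k + 1)
      \<or> avg_outdegree_quasiregular G vs (k + 1) (gcd L (imprimitivity_index G vs))"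
  shows "Min ratios \<le> \<rho>" "\<rho> \<le> Max ratios"
    and "strongly_connected G \<Longrightarrow> Min ratios = \<rho> \<longleftrightarrow> R"
    and "strongly_connected G \<Longrightarrow> \<rho> = Max ratios \<longleftrightarrow> R"
proof -
  define x where "x = (out_sum ^^ k) (\<lambda>_. 1 :: real)"
  have pos: "0 < (out_sum ^^ s) x v" if "v \<in> verts G" for s v
    using that unfolding x_def by (intro out_sum_pow_pos no_sink) simp_all
  have x_pos: "0 < x v" if "v \<in> verts G" for v using pos[OF that, of 0] by simp
  have ratios: "ratios = (\<lambda>u. root L ((out_sum ^^ L) x u / x u)) ` verts G"
    unfolding ratios_def
  proof (intro image_cong refl)
    fix u assume u: "u \<in> verts G"
    have "(out_sum ^^ (k + L)) (\<lambda>_. 1 :: real) u = (out_sum ^^ L) x u"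
      by (simp only: x_def add.commute[of k] funpow_add o_apply)
    then show "root L (real (k_outdegree G (k + L) u) / real (k_outdegree G k u))
        = root L ((out_sum ^^ L) x u / x u)"
      using u by (simp add: real_k_outdegree x_def)
  qed
  have fin: "finite ratios" "ratios \<noteq> {}" using verts_nonempty by (simp_all add: ratios)
  have ratios_pos: "0 < t" if "t \<in> ratios" for t
    using that pos x_pos L by (auto simp: ratios)
  have quotient: "(out_sum ^^ L) x v = root L ((out_sum ^^ L) x v / x v) ^ L * x v"
    if "v \<in> verts G" for v
    using pos[OF that, of L] x_pos[OF that] L by simp
  define m M where "m = Min ratios" and "M = Max ratios"
  have m: "0 < m" "m ^ L * x v \<le> (out_sum ^^ L) x v" and M: "(out_sum ^^ L) x v \<le> M ^ L * x v"
    if "v \<in> verts G" for v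
  proof -
    let ?t = "root L ((out_sum ^^ L) x v / x v)"
    have t: "?t \<in> ratios" using that by (simp add: ratios)
    have "m \<le> ?t" "?t \<le> M" using t fin by (simp_all add: m_def M_def)
    show "0 < m" unfolding m_def using fin by (intro ratios_pos Min_in)
    with \<open>m \<le> ?t\<close> have "m ^ L \<le> ?t ^ L" by (simp add: power_mono)
    then show "m ^ L * x v \<le> (out_sum ^^ L) x v"
      using x_pos[OF that] by (subst quotient[OF that]) (intro mult_right_mono, simp_all)
    have "?t ^ L \<le> M ^ L"
      using \<open>?t \<le> M\<close> ratios_pos[OF t] by (simp add: power_mono)
    then show "(out_sum ^^ L) x v \<le> M ^ L * x v"
      using x_pos[OF that] by (subst quotient[OF that]) (intro mult_right_mono, simp_all)
  qed
  have m0: "0 < m" using m(1) verts_nonempty by blast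
  have mM: "m \<le> M" using fin unfolding m_def M_def by (metis Min_le Max_in)
  have "m ^ L \<le> \<rho> ^ L"
    using x_pos m(2) _ L by (rule pow_ge_imp_le_radius) (use m0 in simp_all)
  then show le1: "Min ratios \<le> \<rho>"
    using radius_nonneg m0 L by (simp flip: m_def)
  have "\<rho> ^ L \<le> M ^ L"
    using x_pos M by (rule pow_le_imp_radius_le)
  then show le2: "\<rho> \<le> Max ratios"
    using m0 mM L radius_nonneg by (simp flip: M_def)
  have \<rho>: "0 < \<rho>" using m0 le1 by (simp add: m_def)

  \<comment> \<open>Under \<open>R\<close> all ratios coincide, so minimum and maximum agree and
    enclose \<rho>.\<close>
  have R_eq: "Min ratios = \<rho>" "\<rho> = Max ratios" if R
  proof -
    obtain C where C: "\<And>v. v \<in> verts G \<Longrightarrow> (out_sum ^^ L) x v = C * x v"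
      using power_eigen_of_regular_or_quasiregular[OF no_sink \<open>R\<close>[unfolded R_def]]
      unfolding x_def by blast
    have "(out_sum ^^ L) x v / x v = C" if "v \<in> verts G" for v
      using C[OF that] x_pos[OF that] by simp
    then have "ratios = {root L C}" using verts_nonempty by (auto simp: ratios)
    then show "Min ratios = \<rho>" "\<rho> = Max ratios" using le1 le2 by simp_all
  qed
  assume strong: "strongly_connected G"
  have R_if: R if "\<And>v. v \<in> verts G \<Longrightarrow> (out_sum ^^ L) x v = \<rho> ^ L * x v"
    unfolding R_def using that
    by (intro regular_or_quasiregular_of_power_eigen strong no_sink L \<rho>) (simp add: x_def)
  show "Min ratios = \<rho> \<longleftrightarrow> R"
  proof
    assume eq: "Min ratios = \<rho>"
    show R
    proof (rule R_if)
      fix v assume v: "v \<in> verts G"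
      show "(out_sum ^^ L) x v = \<rho> ^ L * x v"
      proof (rule ccontr)
        assume "(out_sum ^^ L) x v \<noteq> \<rho> ^ L * x v"
        \<comment> \<open>Strict inequality at a single vertex would already push
          \<open>\<rho> ^ L\<close> above \<open>m ^ L\<close>.\<close>
        then have "m ^ L * x v < (out_sum ^^ L) x v" using m(2)[OF v] eq by (simp add: m_def)
        then have "m ^ L < \<rho> ^ L"
          using strong x_pos m(2) m0 L v by (intro pow_ge_strict_imp_less_radius) simp_all
        then show False using eq by (simp add: m_def)
      qed
    qed
  qed (fact R_eq)
  show "\<rho> = Max ratios \<longleftrightarrow> R"
  proof
    assume eq: "\<rho> = Max ratios"
    show R
    proof (rule R_if)
      fix v assume v: "v \<in> verts G"
      show "(out_sum ^^ L) x v = \<rho> ^ L * x v"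
      proof (rule ccontr)
        assume "(out_sum ^^ L) x v \<noteq> \<rho> ^ L * x v"
        then have "(out_sum ^^ L) x v < M ^ L * x v" using M[OF v] eq by (simp add: M_def)
        then have "\<rho> ^ L < M ^ L"
          using strong x_pos M v by (intro pow_le_strict_imp_radius_less) simp_all
        then show False using eq by (simp add: M_def)
      qed
    qed
  qed (fact R_eq)
qed

end

theorem theorem14:
  fixes G :: "('a, 'b) pre_digraph" and vs :: "'a list" and L k :: nat
  assumes "fin_digraph G"
    and "distinct vs" and "set vs = verts G" and "verts G \<noteq> {}"
    and "\<forall>u\<in>verts G. \<not> is_sink G u"
    and "L > 0"
  defines "\<rho> \<equiv> digraph_spectral_radius G vs"
    and "ratios \<equiv> (\<lambda>u. root L (real (k_outdegree G (k + L) u) / real (k_outdegree G k u))) ` verts G"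
    and "r \<equiv> gcd L (imprimitivity_index G vs)"
  shows "Min ratios \<le> \<rho> \<and> \<rho> \<le> Max ratios \<and>
    (strongly_connected G \<longrightarrow>
       (Min ratios = \<rho> \<longleftrightarrow>
          avg_outdegree_regular G (k + 1) \<or> avg_outdegree_quasiregular G vs (k + 1) r) \<and>
       (\<rho> = Max ratios \<longleftrightarrow>
          avg_outdegree_regular G (k + 1) \<or> avg_outdegree_quasiregular G vs (k + 1) r))"
proof -
  interpret fin_digraph G by fact
  interpret enumerated_digraph G vs by unfold_locales fact+
  show ?thesis
    unfolding \<rho>_def ratios_def r_def
    using spectral_radius_walk_bounds[OF assms(5,6), of k] by blast
qed

end
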